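(* Let $\beta\neq 0$ be a constant. An equation $$y''=P(x,y)+3Q(x,y)\,y'+3R(x,y)\,y'^2+S(x,y)\,y'^3 \qquad (\mathrm{E})$$ is equivalent, under a general point transformation $\tilde x=\tilde x(x,y)$, $\tilde y=\tilde y(x,y)$, to the "Painlevé 34" equation with parameter $\beta$, $$\tilde y''=\frac{5\,\tilde y'^2}{6\,\tilde y}-\beta^2\,\tilde y^{1/3}\left(6\tilde y+3\tilde x\,\tilde y^{2/3}+\frac32\right), \qquad (\mathrm{P34}_\beta)$$ if and only if the following conditions hold, where $A,B,F,M,I_1,I_2,I_3,I_4,I_6,I_7,I_9,I_{15},I_{21}$ are the functions of $(x,y)$ attached to (E) as defined in the context: 1. (Case of intermediate degeneration) $A\neq 0$ or $B\neq 0$, but $F=0$. 2. (Case 1.4 of intermediate degeneration) $M\neq 0$, $I_2=0$, $I_7=0$, $I_{21}=0$. 3. $K=0$, where $$K=500I_1^4-7275I_1^3+500I_4I_1^2+32940I_1^2-5475I_4I_1-47628I_1+125I_4^2+13230I_4 .$$ 4. There exists a non-degenerate invariant change of variables $(x,y)\mapsto(\tilde x,\tilde y)$ that connects the equations (E) and $(\mathrm{P34}_\beta)$, given by $$\tilde y=\frac{125}{2}\cdot\frac{(3+20I_1)I_4+3I_1(5I_1-18)(5I_1-43)}{125(10I_1-111)I_4+3(5I_1-18)(225I_1^2-5245I_1+27216)},$$ $$\tilde x=\frac{(120I_3-8)\tilde y^3+(138+180I_3)\tilde y^2+(90I_3+35)\tilde y+15I_3}{2\,\tilde y^{5/3}(2\tilde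 y-35)} .$$ 5. The following invariant is a constant (its value being the square of the parameter): $$\beta^2=-\frac{64}{625}\cdot\frac{\tilde y^6(2\tilde y-35)^4}{I_9\,(2\tilde y+1)^8(2\tilde y-5)^3}.$$ 6. $K_1=0$ and $K_2=0$, where $$K_1=I_6-\frac{6(4\tilde y^2-296\tilde y+175)I_3}{(2\tilde y-5)(2\tilde y-35)}+\frac{(2\tilde y-1)(2\tilde y-5)I_1}{9(2\tilde y+1)^2},$$ $$K_2=\frac{I_{15}}{I_9}-\frac{36(4\tilde y^2-296\tilde y+175)^2}{(2\tilde y-35)^2(2\tilde y-5)^2}.$$ In the formulas for $\tilde x$, $\beta^2$, $K_1$, $K_2$, the expression of $\tilde y$ through $I_1$ and $I_4$ given in condition 4 is substituted for $\tilde y$.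
   Context: Notation. $K_{i.j}=\partial^{i+j}K/\partial x^i\partial y^j$ for a function $K(x,y)$. The class of equations (E) is closed under general (locally invertible) point transformations $\tilde x=\tilde x(x,y)$, $\tilde y=\tilde y(x,y)$; two equations of the class are equivalent if some such transformation takes one into the other. All considerations are local, on domains where the expressions below are defined, with a fixed branch of the fractional powers. A change of variables is non-degenerate if its Jacobian determinant does not vanish. Definitions, for an equation (E) with coefficients $P,Q,R,S$: $$A=P_{0.2}-2Q_{1.1}+R_{2.0}+2PS_{1.0}+SP_{1.0}-3PR_{0.1}-3RP_{0.1}-3QR_{1.0}+6QQ_{0.1},$$ $$B=S_{2.0}-2R_{1.1}+Q_{0.2}-2SP_{0.1}-PS_{0.1}+3SQ_{1.0}+3QS_{1.0}+3RQ_{0.1}-6RR_{1.0},$$ $$G=-BB_{1.0}-3AB_{0.1}+4BA_{0.1}+3SA^2-6RBA+3QB^2,$$ $$H=-AA_{0.1}-3BA_{1.0}+4AB_{1.0}-3PB^2+6QAB-3RA^2,$$ and $F$ is defined by $3F^5=AG+BH$. When $F=0$ and ($A\ne0$ or $B\neq 0$), the quantities $\Omega,N,M,\gamma^1,\gamma^2$ are defined by one set of formulas if $A\neq 0$ and by another if $B\ne 0$. If $A\neq0$: $$\Omega=\frac{2BA_{1.0}(BP+A_{1.0})}{A^3}-\frac{(2B_{1.0}+3BQ)A_{1.0}}{A^2}+\frac{(A_{0.1}-2B_{1.0})BP}{A^2}-\frac{BA_{2.0}+B^2P_{1.0}}{A^2}+\frac{B_{2.0}}{A}+\frac{3B_{1.0}Q+3BQ_{1.0}-B_{0.1}P-BP_{0.1}}{A}+Q_{0.1}-2R_{1.0},$$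 $$N=-\frac{H}{3A},$$ $$M=-\frac{12BN(BP+A_{1.0})}{5A}+\frac{24}{5}BNQ+\frac65NB_{1.0}+\frac65NA_{0.1}-AN_{0.1}+BN_{1.0}-\frac{12}{5}ANR,$$ $$\gamma^1=-\frac{6BN(BP+A_{1.0})}{5A^2}+\frac{18NBQ}{5A}+\frac{6N(B_{1.0}+A_{0.1})}{5A}-N_{0.1}-\frac{12}{5}NR-2\Omega B,$$ $$\gamma^2=-\frac{6N(BP+A_{1.0})}{5A}+N_{1.0}+\frac65NQ+2\Omega A.$$ If $B\neq0$: $$\Omega=\frac{2AB_{0.1}(AS-B_{0.1})}{B^3}+\frac{(2A_{0.1}-3AR)B_{0.1}}{B^2}+\frac{(B_{1.0}-2A_{0.1})AS}{B^2}+\frac{AB_{0.2}-A^2S_{0.1}}{B^2}-\frac{A_{0.2}}{B}+\frac{3A_{0.1}R+3AR_{0.1}-A_{1.0}S-AS_{1.0}}{B}+R_{1.0}-2Q_{0.1},$$ $$N=\frac{G}{3B},$$ $$M=-\frac{12AN(AS-B_{0.1})}{5B}+\frac{24}{5}ANR-\frac65NA_{0.1}-\frac65NB_{1.0}+BN_{1.0}-AN_{0.1}-\frac{12}{5}BNQ,$$ $$\gamma^1=-\frac{6N(AS-B_{0.1})}{5B}-N_{0.1}+\frac65NR-2\Omega B,$$ $$\gamma^2=-\frac{6AN(AS-B_{0.1})}{5B^2}+\frac{18NAR}{5B}-\frac{6N(A_{0.1}+B_{1.0})}{5B}+N_{1.0}-\frac{12}{5}NQ+2\Omega A.$$ When moreover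 $M\neq0$, put $$\hat\Gamma^1_{22}=\frac{\gamma^1\gamma^2(\gamma^1_{1.0}-\gamma^2_{0.1})}{M}+\frac{(\gamma^2)^2\gamma^1_{0.1}-(\gamma^1)^2\gamma^2_{1.0}}{M}+\frac{P(\gamma^1)^3+3Q(\gamma^1)^2\gamma^2+3R\gamma^1(\gamma^2)^2+S(\gamma^2)^3}{M},$$ $$I_1=\frac{M}{N^2},\qquad I_2=\frac{\Omega^2}{N},\qquad I_3=\frac{\hat\Gamma^1_{22}}{M},$$ $$I_4=\frac{B(I_1)'_x-A(I_1)'_y}{N},\qquad I_6=\frac{B(I_3)'_x-A(I_3)'_y}{N},$$ $$I_7=\frac{(\gamma^1(I_1)'_x+\gamma^2(I_1)'_y)^2}{N^3},\qquad I_9=\frac{(\gamma^1(I_3)'_x+\gamma^2(I_3)'_y)^2}{N^3},$$ $$I_{15}=\frac{(\gamma^1(I_6)'_x+\gamma^2(I_6)'_y)^2}{N^3},\qquad I_{21}=\frac{(\gamma^1(I_9)'_x+\gamma^2(I_9)'_y)^2}{N^3}.$$ *)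

theory Defs
  imports "HOL-Analysis.Analysis"
begin

(* The base field is any real_normed_field; up to isomorphism there are exactly two of them, the
   real and the complex numbers, so that the smooth real and the holomorphic setting are covered
   at once. A point (x, y) of the plane is a pair, denoted z below. *)

definition pdx :: "('a::real_normed_field \<times> 'a \<Rightarrow> 'a) \<Rightarrow> 'a \<times> 'a \<Rightarrow> 'a" where
  "pdx f z = deriv (\<lambda>t. f (t, snd z)) (fst z)"

definition pdy :: "('a::real_normed_field \<times> 'a \<Rightarrow> 'a) \<Rightarrow> 'a \<times> 'a \<Rightarrow> 'a" where
  "pdy f z = deriv (\<lambda>t. f (fst z, t)) (snd z)"

definition pd :: "nat \<Rightarrow> nat \<Rightarrow> ('a::real_normed_field \<times> 'a \<Rightarrow> 'a) \<Rightarrow> 'a \<times> 'a \<Rightarrow> 'a" where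
  "pd i j f = (pdx ^^ i) ((pdy ^^ j) f)"

(* The Frechet derivative is required to be linear over the base field; for complex numbers this
   makes every function of class Suc 0 holomorphic. *)
primrec class_C :: "nat \<Rightarrow> ('a::real_normed_field \<times> 'a) set \<Rightarrow> ('a \<times> 'a \<Rightarrow> 'a) \<Rightarrow> bool" where
  "class_C 0 U f = continuous_on U f"
| "class_C (Suc n) U f =
     ((\<forall>z\<in>U. (f has_derivative (\<lambda>h. pdx f z * fst h + pdy f z * snd h)) (at z)) \<and>
      class_C n U (pdx f) \<and> class_C n U (pdy f))"

definition smooth_on :: "('a::real_normed_field \<times> 'a) set \<Rightarrow> ('a \<times> 'a \<Rightarrow> 'a) \<Rightarrow> bool" where
  "smooth_on U f \<longleftrightarrow> (\<forall>n. class_C n U f)"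

definition jacobian ::
  "('a::real_normed_field \<times> 'a \<Rightarrow> 'a) \<Rightarrow> ('a \<times> 'a \<Rightarrow> 'a) \<Rightarrow> 'a \<times> 'a \<Rightarrow> 'a" where
  "jacobian X Y z = pdx X z * pdy Y z - pdy X z * pdx Y z"

(* A second-order equation y'' = f (x, y) y' is represented by its right-hand side f. If a curve
   y(x) through z has y' = p and y'' = w there, then its image under (X, Y) has
   first derivative D Y / D X and second derivative D (D Y / D X) / D X, where D = d/dx is the
   total derivative along the curve; written out, these are prolong1 and prolong2. *)
definition totderiv :: "('a::real_normed_field \<times> 'a \<Rightarrow> 'a) \<Rightarrow> 'a \<times> 'a \<Rightarrow> 'a \<Rightarrow> 'a" where
  "totderiv X z p = pd 1 0 X z + pd 0 1 X z * p"

definition totderiv2 :: "('a::real_normed_field \<times> 'a \<Rightarrow> 'a) \<Rightarrow> 'a \<times> 'a \<Rightarrow> 'a \<Rightarrow> 'a \<Rightarrow> 'a" where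
  "totderiv2 X z p w =
     pd 2 0 X z + 2 * pd 1 1 X z * p + pd 0 2 X z * p ^ 2 + pd 0 1 X z * w"

definition prolong1 ::
  "('a::real_normed_field \<times> 'a \<Rightarrow> 'a) \<Rightarrow> ('a \<times> 'a \<Rightarrow> 'a) \<Rightarrow> 'a \<times> 'a \<Rightarrow> 'a \<Rightarrow> 'a" where
  "prolong1 X Y z p = totderiv Y z p / totderiv X z p"

definition prolong2 ::
  "('a::real_normed_field \<times> 'a \<Rightarrow> 'a) \<Rightarrow> ('a \<times> 'a \<Rightarrow> 'a) \<Rightarrow> 'a \<times> 'a \<Rightarrow> 'a \<Rightarrow> 'a \<Rightarrow> 'a" where
  "prolong2 X Y z p w =
     (totderiv2 Y z p w * totderiv X z p - totderiv Y z p * totderiv2 X z p w)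
       / totderiv X z p ^ 3"

(* (X, Y) is a non-degenerate smooth change of variables on U, with values in the domain W of the
   equation g, that takes the equation f into the equation g. *)
definition connects ::
  "('a::real_normed_field \<times> 'a) set \<Rightarrow> ('a \<times> 'a \<Rightarrow> 'a \<Rightarrow> 'a) \<Rightarrow>
   ('a \<times> 'a) set \<Rightarrow> ('a \<times> 'a \<Rightarrow> 'a \<Rightarrow> 'a) \<Rightarrow>
   ('a \<times> 'a \<Rightarrow> 'a) \<Rightarrow> ('a \<times> 'a \<Rightarrow> 'a) \<Rightarrow> bool" where
  "connects U f W g X Y \<longleftrightarrow>
     smooth_on U X \<and> smooth_on U Y \<and>
     (\<forall>z\<in>U. (X z, Y z) \<in> W \<and> jacobian X Y z \<noteq> 0 \<and>
        (\<forall>p w. totderiv X z p \<noteq> 0 \<longrightarrow>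
           (w = f z p \<longleftrightarrow> prolong2 X Y z p w = g (X z, Y z) (prolong1 X Y z p))))"

definition equivalent_on ::
  "('a::real_normed_field \<times> 'a) set \<Rightarrow> ('a \<times> 'a \<Rightarrow> 'a \<Rightarrow> 'a) \<Rightarrow>
   ('a \<times> 'a) set \<Rightarrow> ('a \<times> 'a \<Rightarrow> 'a \<Rightarrow> 'a) \<Rightarrow> bool" where
  "equivalent_on U f W g \<longleftrightarrow> (\<exists>X Y. connects U f W g X Y)"

(* The powers with exponent k/3 are (cbrt y) ^ k for a fixed branch cbrt of the cube root on V. *)
definition cube_root_branch :: "'a::real_normed_field set \<Rightarrow> ('a \<Rightarrow> 'a) \<Rightarrow> bool" where
  "cube_root_branch V cbrt \<longleftrightarrow>
     open V \<and> 0 \<notin> V \<and> continuous_on V cbrt \<and> (\<forall>y\<in>V. cbrt y ^ 3 = y)"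

definition painleve34 ::
  "('a::real_normed_field \<Rightarrow> 'a) \<Rightarrow> 'a \<Rightarrow> 'a \<times> 'a \<Rightarrow> 'a \<Rightarrow> 'a" where
  "painleve34 cbrt \<beta> = (\<lambda>(x, y) p.
     5 * p ^ 2 / (6 * y) - \<beta> ^ 2 * cbrt y * (6 * y + 3 * x * cbrt y ^ 2 + 3 / 2))"

(* Selects between the two sets of formulas for Omega, N, M, gamma1, gamma2. *)
datatype formula_set = A_nonzero | B_nonzero

locale cubic_ode =
  fixes P Q R S :: "'a::real_normed_field \<times> 'a \<Rightarrow> 'a"
begin

definition rhs :: "'a \<times> 'a \<Rightarrow> 'a \<Rightarrow> 'a" where
  "rhs z p = P z + 3 * Q z * p + 3 * R z * p ^ 2 + S z * p ^ 3"

definition A :: "'a \<times> 'a \<Rightarrow> 'a" where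
  "A z = pd 0 2 P z - 2 * pd 1 1 Q z + pd 2 0 R z + 2 * P z * pd 1 0 S z + S z * pd 1 0 P z
     - 3 * P z * pd 0 1 R z - 3 * R z * pd 0 1 P z - 3 * Q z * pd 1 0 R z
     + 6 * Q z * pd 0 1 Q z"

definition B :: "'a \<times> 'a \<Rightarrow> 'a" where
  "B z = pd 2 0 S z - 2 * pd 1 1 R z + pd 0 2 Q z - 2 * S z * pd 0 1 P z - P z * pd 0 1 S z
     + 3 * S z * pd 1 0 Q z + 3 * Q z * pd 1 0 S z + 3 * R z * pd 0 1 Q z
     - 6 * R z * pd 1 0 R z"

definition G :: "'a \<times> 'a \<Rightarrow> 'a" where
  "G z = - B z * pd 1 0 B z - 3 * A z * pd 0 1 B z + 4 * B z * pd 0 1 A z + 3 * S z * A z ^ 2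
     - 6 * R z * B z * A z + 3 * Q z * B z ^ 2"

definition H :: "'a \<times> 'a \<Rightarrow> 'a" where
  "H z = - A z * pd 0 1 A z - 3 * B z * pd 1 0 A z + 4 * A z * pd 1 0 B z - 3 * P z * B z ^ 2
     + 6 * Q z * A z * B z - 3 * R z * A z ^ 2"

(* v is a value at z of the quantity F, which is given only through its fifth power. *)
definition F_value :: "'a \<times> 'a \<Rightarrow> 'a \<Rightarrow> bool" where
  "F_value z v \<longleftrightarrow> 3 * v ^ 5 = A z * G z + B z * H z"

primrec applies :: "formula_set \<Rightarrow> 'a \<times> 'a \<Rightarrow> bool" where
  "applies A_nonzero z = (A z \<noteq> 0)"
| "applies B_nonzero z = (B z \<noteq> 0)"

primrec Omega :: "formula_set \<Rightarrow> 'a \<times> 'a \<Rightarrow> 'a" where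
  "Omega A_nonzero z =
     2 * B z * pd 1 0 A z * (B z * P z + pd 1 0 A z) / A z ^ 3
     - (2 * pd 1 0 B z + 3 * B z * Q z) * pd 1 0 A z / A z ^ 2
     + (pd 0 1 A z - 2 * pd 1 0 B z) * B z * P z / A z ^ 2
     - (B z * pd 2 0 A z + B z ^ 2 * pd 1 0 P z) / A z ^ 2
     + pd 2 0 B z / A z
     + (3 * pd 1 0 B z * Q z + 3 * B z * pd 1 0 Q z - pd 0 1 B z * P z - B z * pd 0 1 P z) / A z
     + pd 0 1 Q z - 2 * pd 1 0 R z"
| "Omega B_nonzero z =
     2 * A z * pd 0 1 B z * (A z * S z - pd 0 1 B z) / B z ^ 3
     + (2 * pd 0 1 A z - 3 * A z * R z) * pd 0 1 B z / B z ^ 2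
     + (pd 1 0 B z - 2 * pd 0 1 A z) * A z * S z / B z ^ 2
     + (A z * pd 0 2 B z - A z ^ 2 * pd 0 1 S z) / B z ^ 2
     - pd 0 2 A z / B z
     + (3 * pd 0 1 A z * R z + 3 * A z * pd 0 1 R z - pd 1 0 A z * S z - A z * pd 1 0 S z) / B z
     + pd 1 0 R z - 2 * pd 0 1 Q z"

primrec N :: "formula_set \<Rightarrow> 'a \<times> 'a \<Rightarrow> 'a" where
  "N A_nonzero z = - (H z / (3 * A z))"
| "N B_nonzero z = G z / (3 * B z)"

primrec M :: "formula_set \<Rightarrow> 'a \<times> 'a \<Rightarrow> 'a" where
  "M A_nonzero z =
     - (12 * B z * N A_nonzero z * (B z * P z + pd 1 0 A z) / (5 * A z))
     + 24 / 5 * B z * N A_nonzero z * Q z + 6 / 5 * N A_nonzero z * pd 1 0 B z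
     + 6 / 5 * N A_nonzero z * pd 0 1 A z - A z * pd 0 1 (N A_nonzero) z
     + B z * pd 1 0 (N A_nonzero) z - 12 / 5 * A z * N A_nonzero z * R z"
| "M B_nonzero z =
     - (12 * A z * N B_nonzero z * (A z * S z - pd 0 1 B z) / (5 * B z))
     + 24 / 5 * A z * N B_nonzero z * R z - 6 / 5 * N B_nonzero z * pd 0 1 A z
     - 6 / 5 * N B_nonzero z * pd 1 0 B z + B z * pd 1 0 (N B_nonzero) z
     - A z * pd 0 1 (N B_nonzero) z - 12 / 5 * B z * N B_nonzero z * Q z"

primrec gamma1 :: "formula_set \<Rightarrow> 'a \<times> 'a \<Rightarrow> 'a" where
  "gamma1 A_nonzero z =
     - (6 * B z * N A_nonzero z * (B z * P z + pd 1 0 A z) / (5 * A z ^ 2))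
     + 18 * N A_nonzero z * B z * Q z / (5 * A z)
     + 6 * N A_nonzero z * (pd 1 0 B z + pd 0 1 A z) / (5 * A z)
     - pd 0 1 (N A_nonzero) z - 12 / 5 * N A_nonzero z * R z - 2 * Omega A_nonzero z * B z"
| "gamma1 B_nonzero z =
     - (6 * N B_nonzero z * (A z * S z - pd 0 1 B z) / (5 * B z))
     - pd 0 1 (N B_nonzero) z + 6 / 5 * N B_nonzero z * R z - 2 * Omega B_nonzero z * B z"

primrec gamma2 :: "formula_set \<Rightarrow> 'a \<times> 'a \<Rightarrow> 'a" where
  "gamma2 A_nonzero z =
     - (6 * N A_nonzero z * (B z * P z + pd 1 0 A z) / (5 * A z))
     + pd 1 0 (N A_nonzero) z + 6 / 5 * N A_nonzero z * Q z + 2 * Omega A_nonzero z * A z"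
| "gamma2 B_nonzero z =
     - (6 * A z * N B_nonzero z * (A z * S z - pd 0 1 B z) / (5 * B z ^ 2))
     + 18 * N B_nonzero z * A z * R z / (5 * B z)
     - 6 * N B_nonzero z * (pd 0 1 A z + pd 1 0 B z) / (5 * B z)
     + pd 1 0 (N B_nonzero) z - 12 / 5 * N B_nonzero z * Q z + 2 * Omega B_nonzero z * A z"

definition Gamma :: "formula_set \<Rightarrow> 'a \<times> 'a \<Rightarrow> 'a" where
  "Gamma s z =
     gamma1 s z * gamma2 s z * (pd 1 0 (gamma1 s) z - pd 0 1 (gamma2 s) z) / M s z
     + (gamma2 s z ^ 2 * pd 0 1 (gamma1 s) z - gamma1 s z ^ 2 * pd 1 0 (gamma2 s) z) / M s z
     + (P z * gamma1 s z ^ 3 + 3 * Q z * gamma1 s z ^ 2 * gamma2 s z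
        + 3 * R z * gamma1 s z * gamma2 s z ^ 2 + S z * gamma2 s z ^ 3) / M s z"

definition I1 :: "formula_set \<Rightarrow> 'a \<times> 'a \<Rightarrow> 'a" where
  "I1 s z = M s z / N s z ^ 2"

definition I2 :: "formula_set \<Rightarrow> 'a \<times> 'a \<Rightarrow> 'a" where
  "I2 s z = Omega s z ^ 2 / N s z"

definition I3 :: "formula_set \<Rightarrow> 'a \<times> 'a \<Rightarrow> 'a" where
  "I3 s z = Gamma s z / M s z"

definition I4 :: "formula_set \<Rightarrow> 'a \<times> 'a \<Rightarrow> 'a" where
  "I4 s z = (B z * pd 1 0 (I1 s) z - A z * pd 0 1 (I1 s) z) / N s z"

definition I6 :: "formula_set \<Rightarrow> 'a \<times> 'a \<Rightarrow> 'a" where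
  "I6 s z = (B z * pd 1 0 (I3 s) z - A z * pd 0 1 (I3 s) z) / N s z"

definition I7 :: "formula_set \<Rightarrow> 'a \<times> 'a \<Rightarrow> 'a" where
  "I7 s z = (gamma1 s z * pd 1 0 (I1 s) z + gamma2 s z * pd 0 1 (I1 s) z) ^ 2 / N s z ^ 3"

definition I9 :: "formula_set \<Rightarrow> 'a \<times> 'a \<Rightarrow> 'a" where
  "I9 s z = (gamma1 s z * pd 1 0 (I3 s) z + gamma2 s z * pd 0 1 (I3 s) z) ^ 2 / N s z ^ 3"

definition I15 :: "formula_set \<Rightarrow> 'a \<times> 'a \<Rightarrow> 'a" where
  "I15 s z = (gamma1 s z * pd 1 0 (I6 s) z + gamma2 s z * pd 0 1 (I6 s) z) ^ 2 / N s z ^ 3"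

definition I21 :: "formula_set \<Rightarrow> 'a \<times> 'a \<Rightarrow> 'a" where
  "I21 s z = (gamma1 s z * pd 1 0 (I9 s) z + gamma2 s z * pd 0 1 (I9 s) z) ^ 2 / N s z ^ 3"

definition K :: "formula_set \<Rightarrow> 'a \<times> 'a \<Rightarrow> 'a" where
  "K s z = 500 * I1 s z ^ 4 - 7275 * I1 s z ^ 3 + 500 * I4 s z * I1 s z ^ 2
     + 32940 * I1 s z ^ 2 - 5475 * I4 s z * I1 s z - 47628 * I1 s z + 125 * I4 s z ^ 2
     + 13230 * I4 s z"

definition ytilde_denom :: "formula_set \<Rightarrow> 'a \<times> 'a \<Rightarrow> 'a" where
  "ytilde_denom s z = 125 * (10 * I1 s z - 111) * I4 s z
     + 3 * (5 * I1 s z - 18) * (225 * I1 s z ^ 2 - 5245 * I1 s z + 27216)"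

definition ytilde :: "formula_set \<Rightarrow> 'a \<times> 'a \<Rightarrow> 'a" where
  "ytilde s z = 125 / 2 *
     (((3 + 20 * I1 s z) * I4 s z + 3 * I1 s z * (5 * I1 s z - 18) * (5 * I1 s z - 43))
       / ytilde_denom s z)"

definition xtilde :: "('a \<Rightarrow> 'a) \<Rightarrow> formula_set \<Rightarrow> 'a \<times> 'a \<Rightarrow> 'a" where
  "xtilde cbrt s z =
     ((120 * I3 s z - 8) * ytilde s z ^ 3 + (138 + 180 * I3 s z) * ytilde s z ^ 2
       + (90 * I3 s z + 35) * ytilde s z + 15 * I3 s z)
     / (2 * cbrt (ytilde s z) ^ 5 * (2 * ytilde s z - 35))"

definition beta_squared :: "formula_set \<Rightarrow> 'a \<times> 'a \<Rightarrow> 'a" where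
  "beta_squared s z = - (64 / 625) *
     (ytilde s z ^ 6 * (2 * ytilde s z - 35) ^ 4
       / (I9 s z * (2 * ytilde s z + 1) ^ 8 * (2 * ytilde s z - 5) ^ 3))"

definition K1 :: "formula_set \<Rightarrow> 'a \<times> 'a \<Rightarrow> 'a" where
  "K1 s z = I6 s z
     - 6 * (4 * ytilde s z ^ 2 - 296 * ytilde s z + 175) * I3 s z
       / ((2 * ytilde s z - 5) * (2 * ytilde s z - 35))
     + (2 * ytilde s z - 1) * (2 * ytilde s z - 5) * I1 s z / (9 * (2 * ytilde s z + 1) ^ 2)"

definition K2 :: "formula_set \<Rightarrow> 'a \<times> 'a \<Rightarrow> 'a" where
  "K2 s z = I15 s z / I9 s z
     - 36 * (4 * ytilde s z ^ 2 - 296 * ytilde s z + 175) ^ 2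
       / ((2 * ytilde s z - 35) ^ 2 * (2 * ytilde s z - 5) ^ 2)"

(* Division by zero yields zero in HOL. That the expressions occurring in a condition are defined
   is therefore stated explicitly, by the non-vanishing of their denominators. *)

definition condition1 :: "'a \<times> 'a \<Rightarrow> bool" where
  "condition1 z \<longleftrightarrow> (A z \<noteq> 0 \<or> B z \<noteq> 0) \<and> F_value z 0"

definition condition2 :: "formula_set \<Rightarrow> 'a \<times> 'a \<Rightarrow> bool" where
  "condition2 s z \<longleftrightarrow> N s z \<noteq> 0 \<and> M s z \<noteq> 0 \<and> I2 s z = 0 \<and> I7 s z = 0 \<and> I21 s z = 0"

definition condition3 :: "formula_set \<Rightarrow> 'a \<times> 'a \<Rightarrow> bool" where
  "condition3 s z \<longleftrightarrow> K s z = 0"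

definition condition4 ::
  "'a set \<Rightarrow> ('a \<Rightarrow> 'a) \<Rightarrow> 'a \<Rightarrow> formula_set \<Rightarrow> ('a \<times> 'a) set \<Rightarrow> bool" where
  "condition4 V cbrt \<beta> s U \<longleftrightarrow>
     (\<forall>z\<in>U. ytilde_denom s z \<noteq> 0 \<and> 2 * ytilde s z - 35 \<noteq> 0) \<and>
     connects U rhs (UNIV \<times> V) (painleve34 cbrt \<beta>) (xtilde cbrt s) (ytilde s)"

definition condition5 :: "'a \<Rightarrow> formula_set \<Rightarrow> 'a \<times> 'a \<Rightarrow> bool" where
  "condition5 \<beta> s z \<longleftrightarrow>
     I9 s z \<noteq> 0 \<and> 2 * ytilde s z + 1 \<noteq> 0 \<and> 2 * ytilde s z - 5 \<noteq> 0 \<and>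
     \<beta> ^ 2 = beta_squared s z"

definition condition6 :: "formula_set \<Rightarrow> 'a \<times> 'a \<Rightarrow> bool" where
  "condition6 s z \<longleftrightarrow> K1 s z = 0 \<and> K2 s z = 0"

(* Each set of formulas is used on the part of U where it applies; where both A and B are nonzero,
   the conditions are required for both sets. *)
definition conditions_on :: "'a set \<Rightarrow> ('a \<Rightarrow> 'a) \<Rightarrow> 'a \<Rightarrow> ('a \<times> 'a) set \<Rightarrow> bool" where
  "conditions_on V cbrt \<beta> U \<longleftrightarrow>
     (\<forall>z\<in>U. condition1 z) \<and>
     (\<forall>s. (\<forall>z\<in>{z\<in>U. applies s z}.
             condition2 s z \<and> condition3 s z \<and> condition5 \<beta> s z \<and> condition6 s z) \<and>
          condition4 V cbrt \<beta> s {z\<in>U. applies s z})"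

end

end

theory Submission
  imports Defs
begin

text \<open>
  The conditions contain the change of variables (condition 4), so only their necessity is at
  stake. Suppose (X, Y) takes the equation into the Painleve equation. The coefficients P, Q, R,
  S are the projective components of the pullback of an affine connection adapted to the target
  equation. Using its Christoffel symbols instead of the second derivatives of X and Y, and
  eliminating the third derivatives by means of the curvature, one finds in turn how A and B,
  then N and Omega, then M and gamma, and finally Gamma transform: each is the value for the
  target equation, transported by the Jacobian matrix and scaled by a power of its determinant.
  For the target equation B, F and Omega vanish, I1 depends on Y alone and I3 is affine in X.
  Hence differentiation along gamma annihilates functions of Y, which gives I7 = I21 = 0, and
  the other conditions are identities between rational functions of X and a cube root of Y. They
  hold where Y avoids -1/2, 5/2 and 35/2, and this is the case on a smaller open set because Y
  has no critical point.
\<close>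

subsection \<open>Partial derivatives\<close>

text \<open>The obstacle is size: the invariants contain successive derivatives of P, Q, R, S, which
  already contain second derivatives of X and Y. The equation determines only four combinations of
  the six Christoffel symbols of a connection. Fixing all six, by pulling back a connection with
  just two nonzero symbols, expresses the second derivatives of X and Y through first derivatives
  and leaves one scalar curvature function; the transformation laws then become polynomial
  identities in a few atoms.

  The differentiations in the invariants are simple in the target variables: up to scale, (B, -A) is
  the derivative in Y at fixed X, and gamma the derivative in X at fixed Y. Conditions 3 to 6 can be
  read as elimination: \<open>K\<close> vanishes along the curve Y -> (I1, I4),
  \<open>ytilde\<close> recovers its parameter, \<open>xtilde\<close> solves I3 for X, and I9
  carries the parameter \<beta>.\<close>

definition partials :: "('a::real_normed_field \<times> 'a) set \<Rightarrow> ('a \<times> 'a \<Rightarrow> 'a) \<Rightarrow>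
    ('a \<times> 'a \<Rightarrow> 'a) \<Rightarrow> ('a \<times> 'a \<Rightarrow> 'a) \<Rightarrow> bool" where
  "partials U f fx fy \<longleftrightarrow>
     (\<forall>z\<in>U. (f has_derivative (\<lambda>h. fx z * fst h + fy z * snd h)) (at z))"

lemma partials_DERIV_fst:
  assumes "partials U f fx fy" "(u, v) \<in> U"
  shows "((\<lambda>t. f (t, v)) has_field_derivative fx (u, v)) (at u within T)"
proof -
  have 1: "((\<lambda>t. (t, v)) has_derivative (\<lambda>h. (h, 0))) (at u within T)"
    by (auto intro!: derivative_eq_intros)
  have "(f has_derivative (\<lambda>h. fx (u, v) * fst h + fy (u, v) * snd h)) (at (u, v))"
    using assms by (auto simp: partials_def)
  from has_derivative_compose[OF 1 this] show ?thesis
    by (simp add: has_field_derivative_def)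
qed

lemma partials_DERIV_snd:
  assumes "partials U f fx fy" "(u, v) \<in> U"
  shows "((\<lambda>t. f (u, t)) has_field_derivative fy (u, v)) (at v within T)"
proof -
  have 1: "((\<lambda>t. (u, t)) has_derivative (\<lambda>h. (0, h))) (at v within T)"
    by (auto intro!: derivative_eq_intros)
  have "(f has_derivative (\<lambda>h. fx (u, v) * fst h + fy (u, v) * snd h)) (at (u, v))"
    using assms by (auto simp: partials_def)
  from has_derivative_compose[OF 1 this] show ?thesis
    by (simp add: has_field_derivative_def)
qed

lemma partials_pdx: "partials U f fx fy \<Longrightarrow> z \<in> U \<Longrightarrow> pdx f z = fx z"
  unfolding pdx_def using partials_DERIV_fst[of U f fx fy "fst z" "snd z" UNIV]
  by (auto intro: DERIV_imp_deriv)

lemma partials_pdy: "partials U f fx fy \<Longrightarrow> z \<in> U \<Longrightarrow> pdy f z = fy z"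
  unfolding pdy_def using partials_DERIV_snd[of U f fx fy "fst z" "snd z" UNIV]
  by (auto intro: DERIV_imp_deriv)

lemma partials_cong:
  assumes "partials U f fx fy" "open U" "\<And>z. z \<in> U \<Longrightarrow> g z = f z"
    "\<And>z. z \<in> U \<Longrightarrow> gx z = fx z" "\<And>z. z \<in> U \<Longrightarrow> gy z = fy z"
  shows "partials U g gx gy"
  unfolding partials_def
proof
  fix z assume z: "z \<in> U"
  have "(f has_derivative (\<lambda>h. gx z * fst h + gy z * snd h)) (at z)"
    using assms(1,4,5) z by (auto simp: partials_def)
  then show "(g has_derivative (\<lambda>h. gx z * fst h + gy z * snd h)) (at z)"
    by (rule has_derivative_transform_within_open[OF _ assms(2) z]) (simp add: assms(3))
qed

lemma partials_subset: "partials U f fx fy \<Longrightarrow> T \<subseteq> U \<Longrightarrow> partials T f fx fy"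
  by (auto simp: partials_def)

lemma partials_unique:
  assumes "partials U f fx fy" "partials U f gx gy" "z \<in> U"
  shows "fx z = gx z" "fy z = gy z"
  using assms partials_pdx partials_pdy by metis+

lemma partials_const: "partials U (\<lambda>_. c) (\<lambda>_. 0) (\<lambda>_. 0)"
  by (simp add: partials_def)

lemma partials_add:
  "partials U f fx fy \<Longrightarrow> partials U g gx gy \<Longrightarrow>
   partials U (\<lambda>z. f z + g z) (\<lambda>z. fx z + gx z) (\<lambda>z. fy z + gy z)"
  unfolding partials_def
  by (auto intro!: derivative_eq_intros simp: algebra_simps)

lemma partials_diff:
  "partials U f fx fy \<Longrightarrow> partials U g gx gy \<Longrightarrow>
   partials U (\<lambda>z. f z - g z) (\<lambda>z. fx z - gx z) (\<lambda>z. fy z - gy z)"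
  unfolding partials_def
  by (auto intro!: derivative_eq_intros simp: algebra_simps)

lemma partials_minus:
  "partials U f fx fy \<Longrightarrow> partials U (\<lambda>z. - f z) (\<lambda>z. - fx z) (\<lambda>z. - fy z)"
  using partials_diff[OF partials_const[of U 0]] by simp

lemma partials_mult:
  "partials U f fx fy \<Longrightarrow> partials U g gx gy \<Longrightarrow>
   partials U (\<lambda>z. f z * g z) (\<lambda>z. fx z * g z + f z * gx z) (\<lambda>z. fy z * g z + f z * gy z)"
  unfolding partials_def
  by (auto intro!: derivative_eq_intros simp: algebra_simps)

lemma partials_cmult:
  "partials U f fx fy \<Longrightarrow> partials U (\<lambda>z. c * f z) (\<lambda>z. c * fx z) (\<lambda>z. c * fy z)"
  using partials_mult[OF partials_const[of U c]] by simp

lemma partials_power: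
  "partials U f fx fy \<Longrightarrow> partials U (\<lambda>z. f z ^ n)
     (\<lambda>z. of_nat n * f z ^ (n - 1) * fx z) (\<lambda>z. of_nat n * f z ^ (n - 1) * fy z)"
  unfolding partials_def
  by (auto intro!: derivative_eq_intros simp: algebra_simps)

lemma partials_inverse:
  "partials U f fx fy \<Longrightarrow> (\<And>z. z \<in> U \<Longrightarrow> f z \<noteq> 0) \<Longrightarrow>
   partials U (\<lambda>z. inverse (f z)) (\<lambda>z. - (fx z / f z ^ 2)) (\<lambda>z. - (fy z / f z ^ 2))"
  unfolding partials_def
  by (auto intro!: derivative_eq_intros simp: field_simps power2_eq_square)

lemma partials_divide:
  assumes "partials U f fx fy" "partials U g gx gy" "\<And>z. z \<in> U \<Longrightarrow> g z \<noteq> 0" "open U"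
  shows "partials U (\<lambda>z. f z / g z) (\<lambda>z. (fx z * g z - f z * gx z) / g z ^ 2)
     (\<lambda>z. (fy z * g z - f z * gy z) / g z ^ 2)"
  by (rule partials_cong[OF partials_mult[OF assms(1) partials_inverse[OF assms(2,3)]]])
    (use assms in \<open>auto simp: field_simps power2_eq_square\<close>)

section \<open>Closure properties of smooth functions\<close>

lemma class_C_Suc: "class_C (Suc n) U f \<longleftrightarrow>
    partials U f (pdx f) (pdy f) \<and> class_C n U (pdx f) \<and> class_C n U (pdy f)"
  by (simp add: partials_def)

declare class_C.simps(2) [simp del]

lemma partials_continuous_on: "partials U f fx fy \<Longrightarrow> continuous_on U f"
  by (meson partials_def has_derivative_continuous continuous_at_imp_continuous_on)

lemma class_C_SucD: "class_C (Suc n) U f \<Longrightarrow> class_C n U f"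
proof (induction n arbitrary: f)
  case 0
  then show ?case using partials_continuous_on by (auto simp: class_C_Suc)
next
  case (Suc n)
  then show ?case by (subst class_C_Suc, subst (asm) class_C_Suc) blast
qed

lemma class_C_cong:
  assumes "open U"
  shows "class_C n U f \<Longrightarrow> (\<And>z. z \<in> U \<Longrightarrow> g z = f z) \<Longrightarrow> class_C n U g"
proof (induction n arbitrary: f g)
  case 0
  then show ?case using continuous_on_cong by (metis class_C.simps(1))
next
  case (Suc n)
  have p: "partials U f (pdx f) (pdy f)" "class_C n U (pdx f)" "class_C n U (pdy f)"
    using Suc.prems by (auto simp: class_C_Suc)
  have q: "partials U g (pdx f) (pdy f)"
    by (rule partials_cong[OF p(1) assms]) (auto simp: Suc.prems)
  have e: "pdx g z = pdx f z" "pdy g z = pdy f z" if "z \<in> U" for z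
    using partials_pdx[OF q that] partials_pdy[OF q that] by auto
  show ?case
    unfolding class_C_Suc
    using partials_cong[OF q assms, of g "pdx g" "pdy g"] Suc.IH[OF p(2)] Suc.IH[OF p(3)] e
    by auto
qed

text \<open>\<open>class_C\<close> refers to \<open>pdx f\<close> and \<open>pdy f\<close>
  themselves. As U is open, any expressions that agree with them on U may take their place.\<close>

lemma class_C_SucI:
  assumes "open U" "partials U f fx fy" "class_C n U fx" "class_C n U fy"
  shows "class_C (Suc n) U f"
  unfolding class_C_Suc
  using class_C_cong[OF assms(1,3)] class_C_cong[OF assms(1,4)]
    partials_pdx[OF assms(2)] partials_pdy[OF assms(2)]
    partials_cong[OF assms(2,1), of f "pdx f" "pdy f"] by auto

lemma class_C_const: "open U \<Longrightarrow> class_C n U (\<lambda>_. c)"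
  by (induction n arbitrary: c) (auto intro: class_C_SucI partials_const)

lemma class_C_add:
  "open U \<Longrightarrow> class_C n U f \<Longrightarrow> class_C n U g \<Longrightarrow> class_C n U (\<lambda>z. f z + g z)"
proof (induction n arbitrary: f g)
  case 0
  then show ?case by (auto intro: continuous_intros)
next
  case (Suc n)
  then show ?case by (intro class_C_SucI[OF _ partials_add]) (auto simp: class_C_Suc)
qed

lemma class_C_mult:
  "open U \<Longrightarrow> class_C n U f \<Longrightarrow> class_C n U g \<Longrightarrow> class_C n U (\<lambda>z. f z * g z)"
proof (induction n arbitrary: f g)
  case 0
  then show ?case by (auto intro: continuous_intros)
next
  case (Suc n)
  have "class_C n U f" "class_C n U g"
    using Suc.prems class_C_SucD by blast+
  then show ?case using Suc
    by (intro class_C_SucI[OF _ partials_mult] class_C_add) (auto simp: class_C_Suc)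
qed

text \<open>The gradient of 1/f contains 1/f undifferentiated, so class n of 1/f is enough for class
  \<open>Suc n\<close>.\<close>

lemma class_C_inverse:
  "open U \<Longrightarrow> class_C n U f \<Longrightarrow> (\<And>z. z \<in> U \<Longrightarrow> f z \<noteq> 0) \<Longrightarrow>
   class_C n U (\<lambda>z. inverse (f z))"
proof (induction n arbitrary: f)
  case 0
  then show ?case by (auto intro: continuous_intros)
next
  case (Suc n)
  have i: "class_C n U (\<lambda>z. inverse (f z))"
    using Suc class_C_SucD by blast
  have p: "partials U f (pdx f) (pdy f)" "class_C n U (pdx f)" "class_C n U (pdy f)"
    using Suc.prems by (auto simp: class_C_Suc)
  have "partials U (\<lambda>z. inverse (f z))
      (\<lambda>z. (- 1 * pdx f z) * (inverse (f z) * inverse (f z)))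
      (\<lambda>z. (- 1 * pdy f z) * (inverse (f z) * inverse (f z)))"
    by (rule partials_cong[OF partials_inverse[OF p(1) Suc.prems(3)] Suc.prems(1)])
      (auto simp: field_simps power2_eq_square)
  moreover have "class_C n U (\<lambda>z. (- 1 * g z) * (inverse (f z) * inverse (f z)))"
    if "class_C n U g" for g
    using class_C_mult[OF Suc.prems(1) class_C_mult[OF Suc.prems(1) class_C_const that]
        class_C_mult[OF Suc.prems(1) i i]] Suc.prems(1) by blast
  ultimately show ?case
    using p Suc.prems(1) by (blast intro: class_C_SucI)
qed

lemma smooth_on_partials: "smooth_on U f \<Longrightarrow> partials U f (pdx f) (pdy f)"
  using class_C_Suc by (auto simp: smooth_on_def)

lemma smooth_on_pdx: "smooth_on U f \<Longrightarrow> smooth_on U (pdx f)"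
  using class_C_Suc by (auto simp: smooth_on_def)

lemma smooth_on_pdy: "smooth_on U f \<Longrightarrow> smooth_on U (pdy f)"
  using class_C_Suc by (auto simp: smooth_on_def)

lemma smooth_on_const: "open U \<Longrightarrow> smooth_on U (\<lambda>_. c)"
  by (simp add: smooth_on_def class_C_const)

lemma smooth_on_add: "open U \<Longrightarrow> smooth_on U f \<Longrightarrow> smooth_on U g \<Longrightarrow> smooth_on U (\<lambda>z. f z + g z)"
  by (simp add: smooth_on_def class_C_add)

lemma smooth_on_mult: "open U \<Longrightarrow> smooth_on U f \<Longrightarrow> smooth_on U g \<Longrightarrow> smooth_on U (\<lambda>z. f z * g z)"
  by (simp add: smooth_on_def class_C_mult)

lemma smooth_on_diff: "open U \<Longrightarrow> smooth_on U f \<Longrightarrow> smooth_on U g \<Longrightarrow> smooth_on U (\<lambda>z. f z - g z)"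
  using smooth_on_add[of U f "\<lambda>z. - 1 * g z"] smooth_on_mult[OF _ smooth_on_const, of U g "- 1"]
  by simp

lemma smooth_on_minus: "open U \<Longrightarrow> smooth_on U f \<Longrightarrow> smooth_on U (\<lambda>z. - f z)"
  using smooth_on_mult[OF _ smooth_on_const, of U f "- 1"] by simp

lemma smooth_on_power: "open U \<Longrightarrow> smooth_on U f \<Longrightarrow> smooth_on U (\<lambda>z. f z ^ n)"
  by (induction n) (auto intro: smooth_on_const smooth_on_mult)

lemma smooth_on_divide:
  "open U \<Longrightarrow> smooth_on U f \<Longrightarrow> smooth_on U g \<Longrightarrow> (\<And>z. z \<in> U \<Longrightarrow> g z \<noteq> 0) \<Longrightarrow>
   smooth_on U (\<lambda>z. f z / g z)"
  unfolding divide_inverse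
  by (intro smooth_on_mult) (auto simp: smooth_on_def intro: class_C_inverse)

lemma smooth_on_cong:
  "smooth_on U f \<Longrightarrow> open U \<Longrightarrow> (\<And>z. z \<in> U \<Longrightarrow> g z = f z) \<Longrightarrow> smooth_on U g"
  unfolding smooth_on_def using class_C_cong by blast

lemma class_C_subset: "class_C n U f \<Longrightarrow> T \<subseteq> U \<Longrightarrow> class_C n T f"
  by (induction n arbitrary: f)
    (auto simp: class_C_Suc intro: continuous_on_subset partials_subset)

lemma smooth_on_subset: "smooth_on U f \<Longrightarrow> T \<subseteq> U \<Longrightarrow> smooth_on T f"
  unfolding smooth_on_def using class_C_subset by blast

lemma smooth_on_continuous_on: "smooth_on U f \<Longrightarrow> continuous_on U f"
  using smooth_on_partials partials_continuous_on by blast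

lemmas smooth_on_intros =
  smooth_on_const smooth_on_add smooth_on_diff smooth_on_minus smooth_on_mult smooth_on_power
  smooth_on_divide smooth_on_pdx smooth_on_pdy

text \<open>Two applications of the mean value inequality, to \<open>g\<close> in the second
  variable and then to a difference of \<open>f\<close> in the first, each after subtracting the
  linear term in L. Only derivatives along the axes are required, so the variables can be
  exchanged.\<close>

lemma mixed_difference_bound:
  fixes f g k :: "'a::real_normed_field \<times> 'a \<Rightarrow> 'a"
  assumes f: "\<And>u v. u \<in> ball x r \<Longrightarrow> v \<in> ball y r \<Longrightarrow>
      ((\<lambda>t. f (t, v)) has_field_derivative g (u, v)) (at u within ball x r)"
    and g: "\<And>u v. u \<in> ball x r \<Longrightarrow> v \<in> ball y r \<Longrightarrow>
      ((\<lambda>t. g (u, t)) has_field_derivative k (u, v)) (at v within ball y r)"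
    and k: "\<And>u v. u \<in> ball x r \<Longrightarrow> v \<in> ball y r \<Longrightarrow> norm (k (u, v) - L) \<le> e"
    and h: "norm h < r"
  shows "norm (f (x + h, y + h) - f (x + h, y) - f (x, y + h) + f (x, y) - h * h * L)
           \<le> e * norm h * norm h"
proof -
  have mem: "x \<in> ball x r" "x + h \<in> ball x r" "y \<in> ball y r" "y + h \<in> ball y r"
    using h by (auto simp: dist_norm intro: le_less_trans[OF norm_ge_zero])
  have 1: "norm (g (u, y + h) - g (u, y) - h * L) \<le> e * norm h" if u: "u \<in> ball x r" for u
  proof -
    have "norm ((g (u, y + h) - (y + h) * L) - (g (u, y) - y * L)) \<le> e * norm ((y + h) - y)"
      by (rule field_differentiable_bound[where S = "ball y r" and f' = "\<lambda>v. k (u, v) - L"])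
        (use u mem in \<open>auto intro!: derivative_eq_intros g k simp: dist_norm\<close>)
    then show ?thesis by (simp add: algebra_simps)
  qed
  have "norm ((f (x + h, y + h) - f (x + h, y) - (x + h) * (h * L)) -
      (f (x, y + h) - f (x, y) - x * (h * L))) \<le> (e * norm h) * norm ((x + h) - x)"
    by (rule field_differentiable_bound[where S = "ball x r"
          and f = "\<lambda>u. f (u, y + h) - f (u, y) - u * (h * L)"
          and f' = "\<lambda>u. g (u, y + h) - g (u, y) - h * L"])
      (use mem 1 in \<open>auto intro!: derivative_eq_intros f simp: dist_norm\<close>)
  then show ?thesis by (simp add: algebra_simps)
qed

text \<open>The second difference of f over a small square is symmetric in the two variables and is
  h^2 times either mixed derivative, up to a small multiple of |h|^2.\<close>

lemma smooth_on_pdx_pdy: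
  fixes f :: "'a::real_normed_field \<times> 'a \<Rightarrow> 'a"
  assumes f: "smooth_on U f" and U: "open U" and z: "z \<in> U"
  shows "pdx (pdy f) z = pdy (pdx f) z"
proof (rule ccontr)
  assume ne: "pdx (pdy f) z \<noteq> pdy (pdx f) z"
  \<comment> \<open>With a quarter of the gap as tolerance, the two estimates together give 4 e
    |h|^2 \<le> 2 e |h|^2.\<close>
  define e where "e = norm (pdx (pdy f) z - pdy (pdx f) z) / 4"
  have e: "e > 0" using ne by (simp add: e_def)
  obtain x y where xy: "z = (x, y)" by force
  note ff = smooth_on_partials[OF f]
  note fx = smooth_on_partials[OF smooth_on_pdx[OF f]]
  note fy = smooth_on_partials[OF smooth_on_pdy[OF f]]
  have "isCont (pdy (pdx f)) z" "isCont (pdx (pdy f)) z"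
    using smooth_on_continuous_on[OF smooth_on_pdy[OF smooth_on_pdx[OF f]]]
      smooth_on_continuous_on[OF smooth_on_pdx[OF smooth_on_pdy[OF f]]] U z
    by (auto simp: continuous_on_eq_continuous_at)
  then have "\<forall>\<^sub>F w in nhds z. dist (pdy (pdx f) w) (pdy (pdx f) z) < e"
    "\<forall>\<^sub>F w in nhds z. dist (pdx (pdy f) w) (pdx (pdy f) z) < e"
    using e by (auto simp: continuous_at tendsto_iff eventually_at_filter elim!: eventually_mono)
  moreover have "\<forall>\<^sub>F w in nhds z. w \<in> U"
    using U z eventually_nhds by blast
  ultimately have "\<forall>\<^sub>F w in nhds z. w \<in> U \<and> dist (pdy (pdx f) w) (pdy (pdx f) z) < e \<and>
      dist (pdx (pdy f) w) (pdx (pdy f) z) < e"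
    by eventually_elim auto
  then obtain W where W: "open W" "z \<in> W" "\<And>w. w \<in> W \<Longrightarrow>
      w \<in> U \<and> dist (pdy (pdx f) w) (pdy (pdx f) z) < e \<and> dist (pdx (pdy f) w) (pdx (pdy f) z) < e"
    by (auto simp: eventually_nhds)
  obtain W1 W2 where W12: "open W1" "open W2" "x \<in> W1" "y \<in> W2" "W1 \<times> W2 \<subseteq> W"
    using W(1,2) xy by (auto elim: open_prod_elim)
  obtain r1 r2 where r12: "r1 > 0" "r2 > 0" "ball x r1 \<subseteq> W1" "ball y r2 \<subseteq> W2"
    using W12 by (meson openE)
  define r where "r = min r1 r2"
  have r: "r > 0" and rU: "\<And>u v. u \<in> ball x r \<Longrightarrow> v \<in> ball y r \<Longrightarrow> (u, v) \<in> W"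
    using r12 W12(5) by (auto simp: r_def subset_iff)
  define h :: 'a where "h = of_real (r / 2)"
  have h: "norm h < r" "h \<noteq> 0" using r by (auto simp: h_def)
  let ?D = "f (x + h, y + h) - f (x + h, y) - f (x, y + h) + f (x, y)"
  have 1: "norm (?D - h * h * pdy (pdx f) z) \<le> e * norm h * norm h"
    by (rule mixed_difference_bound[where g = "pdx f" and k = "pdy (pdx f)" and r = r])
      (use W(3) rU h in \<open>auto intro!: partials_DERIV_fst[OF ff] partials_DERIV_snd[OF fx]
          simp: dist_norm less_imp_le simp del: mem_ball\<close>)
  \<comment> \<open>The same estimate for f with its arguments exchanged, which leaves
    \<open>?D\<close> unchanged.\<close>
  have 2: "norm (?D - h * h * pdx (pdy f) z) \<le> e * norm h * norm h"
    using mixed_difference_bound[where x = y and y = x and r = r and h = h and e = e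
        and L = "pdx (pdy f) z" and f = "\<lambda>w. f (snd w, fst w)" and g = "\<lambda>w. pdy f (snd w, fst w)"
        and k = "\<lambda>w. pdx (pdy f) (snd w, fst w)"] W(3) rU h
    by (auto intro!: partials_DERIV_snd[OF ff] partials_DERIV_fst[OF fy]
          simp: dist_norm less_imp_le algebra_simps simp del: mem_ball)
  have "norm (h * h * (pdx (pdy f) z - pdy (pdx f) z)) \<le> 2 * (e * norm h * norm h)"
    using norm_triangle_ineq4[of "?D - h * h * pdy (pdx f) z" "?D - h * h * pdx (pdy f) z"] 1 2
    by (simp add: algebra_simps)
  then have "(4 * e) * (norm h * norm h) \<le> (2 * e) * (norm h * norm h)"
    unfolding norm_mult by (simp add: e_def)
  with h e show False by simp
qed

text \<open>Bootstrapping: the gradient of \<open>s\<close> is expressed through Y and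
  \<open>s\<close> itself, so class n of \<open>s\<close> yields class \<open>Suc n\<close>.\<close>

lemma smooth_on_cube_root:
  fixes s Y :: "'a::real_normed_field \<times> 'a \<Rightarrow> 'a"
  assumes U: "open U" and Y: "smooth_on U Y"
    and s: "partials U s (\<lambda>z. pdx Y z / (3 * s z ^ 2)) (\<lambda>z. pdy Y z / (3 * s z ^ 2))"
    and s0: "\<And>z. z \<in> U \<Longrightarrow> s z \<noteq> 0"
  shows "smooth_on U s"
  unfolding smooth_on_def
proof
  fix n show "class_C n U s"
  proof (induction n)
    case 0
    then show ?case using partials_continuous_on[OF s] by simp
  next
    case (Suc n)
    have "class_C n U (pdx Y)" "class_C n U (pdy Y)"
      using smooth_on_pdx[OF Y] smooth_on_pdy[OF Y] by (auto simp: smooth_on_def)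
    with Suc show ?case
      by (intro class_C_SucI[OF U s]; unfold divide_inverse power2_eq_square;
          intro class_C_mult class_C_inverse class_C_const U) (auto simp: s0)
  qed
qed

text \<open>The branch is only assumed continuous; differentiability comes from the inverse function
  rule, as cubing has the nonzero derivative \<open>3 * cbrt y ^ 2\<close> there.\<close>

lemma cube_root_branch_DERIV:
  fixes cbrt :: "'a::real_normed_field \<Rightarrow> 'a"
  assumes "cube_root_branch V cbrt" "y \<in> V"
  shows "cbrt y \<noteq> 0" "cbrt y ^ 3 = y"
    "(cbrt has_field_derivative 1 / (3 * cbrt y ^ 2)) (at y)"
proof -
  have *: "open V" "0 \<notin> V" "continuous_on V cbrt" "\<And>y. y \<in> V \<Longrightarrow> cbrt y ^ 3 = y"
    using assms by (auto simp: cube_root_branch_def)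
  show "cbrt y ^ 3 = y" using *(4) assms by simp
  then show n: "cbrt y \<noteq> 0" using *(2) assms by auto
  have "(cbrt has_derivative (\<lambda>h. h * (1 / (3 * cbrt y ^ 2)))) (at y)"
  proof (rule has_derivative_inverse_basic[where T = V])
    show "((\<lambda>x. x ^ 3) has_derivative (\<lambda>h. h * (3 * cbrt y ^ 2))) (at (cbrt y))"
      by (auto intro!: derivative_eq_intros)
    show "continuous (at y) cbrt"
      using * assms by (simp add: continuous_on_eq_continuous_at)
    show "bounded_linear (\<lambda>h. h * (1 / (3 * cbrt y ^ 2)))"
      by (rule bounded_linear_mult_left)
  qed (use * n assms in auto)
  then show "(cbrt has_field_derivative 1 / (3 * cbrt y ^ 2)) (at y)"
    by (rule has_derivative_imp_has_field_derivative) simp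
qed

lemma partials_compose:
  assumes "partials U f fx fy" "\<And>z. z \<in> U \<Longrightarrow> (\<phi> has_field_derivative \<phi>' (f z)) (at (f z))"
  shows "partials U (\<lambda>z. \<phi> (f z)) (\<lambda>z. \<phi>' (f z) * fx z) (\<lambda>z. \<phi>' (f z) * fy z)"
  unfolding partials_def
proof
  fix z assume z: "z \<in> U"
  have "(f has_derivative (\<lambda>h. fx z * fst h + fy z * snd h)) (at z)"
    using assms z by (auto simp: partials_def)
  from has_derivative_compose[OF this assms(2)[OF z, unfolded has_field_derivative_def]]
  show "((\<lambda>z. \<phi> (f z)) has_derivative
      (\<lambda>h. \<phi>' (f z) * fx z * fst h + \<phi>' (f z) * fy z * snd h)) (at z)"
    by (simp add: algebra_simps)
qed

lemma partials_eqI: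
  assumes "partials U f fx fy" "\<And>z. z \<in> U \<Longrightarrow> fx z = gx z" "\<And>z. z \<in> U \<Longrightarrow> fy z = gy z"
  shows "partials U f gx gy"
  using assms by (auto simp: partials_def)

lemmas partials_intros =
  partials_const partials_add partials_diff partials_minus partials_mult partials_power
  partials_divide

text \<open>Symmetry of mixed derivatives as a compatibility condition: f and g may be any
  expressions for the gradient of h, and the result is an equation between derivatives of these
  expressions.\<close>

lemma partials_mixed:
  assumes "smooth_on U h" "open U" "partials U h f g" "partials U f fx fy" "partials U g gx gy"
    "z \<in> U"
  shows "fy z = gx z"
proof -
  have "partials U (pdx h) fx fy"
    by (rule partials_cong[OF assms(4,2)]) (simp_all add: partials_pdx[OF assms(3)])
  moreover have "partials U (pdy h) gx gy"
    by (rule partials_cong[OF assms(5,2)]) (simp_all add: partials_pdy[OF assms(3)])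
  ultimately show ?thesis
    using smooth_on_pdx_pdy[OF assms(1,2,6)] assms(6) partials_pdx partials_pdy by metis
qed

lemma solve_curvature:
  fixes a b c d k x y :: "'a::field"
  assumes "a * x + b * y = 0" "c * x + d * y = - (k * e * (a * d - b * c))" "a * d - b * c \<noteq> 0"
  shows "x = k * e * b" "y = - (k * e * a)"
proof -
  have "(a * d - b * c) * x = d * (a * x + b * y) - b * (c * x + d * y)"
    "(a * d - b * c) * y = a * (c * x + d * y) - c * (a * x + b * y)"
    by (simp_all add: algebra_simps)
  then have "(a * d - b * c) * x = (a * d - b * c) * (k * e * b)"
    "(a * d - b * c) * y = (a * d - b * c) * (- (k * e * a))"
    unfolding assms(1,2) by (simp_all add: algebra_simps)
  then show "x = k * e * b" "y = - (k * e * a)"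
    using assms(3) mult_cancel_left by blast+
qed

subsection \<open>The pulled-back connection\<close>

text \<open>Here \<open>s\<close> stands for the cube root of Y. Only its cube and its gradient are
  recorded, so the branch disappears and all fractional powers become rational in
  \<open>s\<close>.\<close>

locale p34_transformation =
  fixes U :: "('a::real_normed_field \<times> 'a) set" and X Y s :: "'a \<times> 'a \<Rightarrow> 'a" and \<beta> :: 'a
  assumes open_U: "open U"
    and smooth_X: "smooth_on U X"
    and smooth_Y: "smooth_on U Y"
    and cube: "\<And>z. z \<in> U \<Longrightarrow> Y z = s z ^ 3"
    and s_nonzero: "\<And>z. z \<in> U \<Longrightarrow> s z \<noteq> 0"
    and partials_s: "partials U s (\<lambda>z. pdx Y z / (3 * s z ^ 2)) (\<lambda>z. pdy Y z / (3 * s z ^ 2))"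
    and jacobian_nonzero: "\<And>z. z \<in> U \<Longrightarrow> jacobian X Y z \<noteq> 0"
begin

abbreviation a where "a \<equiv> pdx X"
abbreviation b where "b \<equiv> pdy X"
abbreviation c where "c \<equiv> pdx Y"
abbreviation d where "d \<equiv> pdy Y"

text \<open>
  Along (X, Y) the Painleve equation reads Y'' = \<pi> + \<rho> Y'^2. A trailing X or Y in a name marks a
  partial derivative in the target variables, and \<rho>' is the derivative of \<rho> in Y.
  The target curves are the unparametrised geodesics of the affine connection whose only nonzero
  Christoffel symbols are -\<pi> (upper index 2, lower 11) and -\<rho> (upper index 2, lower 22).
  The functions p, q, r with index 1 or 2 are the Christoffel symbols of its pullback:
  p belongs to the lower indices xx, q to xy, r to yy, and the digit is the upper index.
  All second derivatives of X and Y are eliminated in favour of them. \<kappa> is the curvature of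
  the target connection, and \<alpha> is the value of A for the target equation.
\<close>

definition J where "J z = a z * d z - b z * c z"
definition \<rho> where "\<rho> z = 5 / (6 * s z ^ 3)"
definition \<rho>' where "\<rho>' z = - (5 / (6 * s z ^ 6))"
definition \<pi> where "\<pi> z = - (\<beta> ^ 2 * s z * (6 * s z ^ 3 + 3 * X z * s z ^ 2 + 3 / 2))"
definition \<pi>X where "\<pi>X z = - (3 * \<beta> ^ 2 * s z ^ 3)"
definition \<pi>Y where "\<pi>Y z = - (\<beta> ^ 2 * (8 * s z + 3 * X z + 1 / (2 * s z ^ 2)))"
definition \<kappa> where "\<kappa> z = - (\<beta> ^ 2 * (3 * s z + X z / 2 - 3 / (4 * s z ^ 2)))"
definition \<kappa>X :: 'a where "\<kappa>X = - (\<beta> ^ 2 / 2)"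
definition \<alpha> where "\<alpha> z = - (\<beta> ^ 2 * (2 * s z ^ 3 + 1) / (2 * s z ^ 5))"

definition "kxx z = pdx c z - \<pi> z * a z ^ 2 - \<rho> z * c z ^ 2"
definition "kxy z = pdy c z - \<pi> z * a z * b z - \<rho> z * c z * d z"
definition "kyy z = pdy d z - \<pi> z * b z ^ 2 - \<rho> z * d z ^ 2"

definition "p1 z = (d z * pdx a z - b z * kxx z) / J z"
definition "p2 z = (a z * kxx z - c z * pdx a z) / J z"
definition "q1 z = (d z * pdy a z - b z * kxy z) / J z"
definition "q2 z = (a z * kxy z - c z * pdy a z) / J z"
definition "r1 z = (d z * pdy b z - b z * kyy z) / J z"
definition "r2 z = (a z * kyy z - c z * pdy b z) / J z"

lemma J_nonzero: "z \<in> U \<Longrightarrow> J z \<noteq> 0"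
  using jacobian_nonzero by (simp add: J_def jacobian_def)

lemma smooth_s: "smooth_on U s"
  using smooth_on_cube_root[OF open_U smooth_Y partials_s s_nonzero] by blast

lemmas smooth_intros = open_U smooth_on_intros smooth_X smooth_Y smooth_s

lemma smooth_christoffel:
  "smooth_on U p1" "smooth_on U q1" "smooth_on U r1"
  "smooth_on U p2" "smooth_on U q2" "smooth_on U r2"
proof -
  have J: "smooth_on U J" unfolding J_def by (intro smooth_intros)
  have \<rho>: "smooth_on U \<rho>" unfolding \<rho>_def by (intro smooth_intros) (simp add: s_nonzero)
  have \<pi>: "smooth_on U \<pi>" unfolding \<pi>_def by (intro smooth_intros)
  have k: "smooth_on U kxx" "smooth_on U kxy" "smooth_on U kyy"
    unfolding kxx_def kxy_def kyy_def by (intro smooth_intros \<rho> \<pi>)+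
  show "smooth_on U p1" "smooth_on U q1" "smooth_on U r1"
    "smooth_on U p2" "smooth_on U q2" "smooth_on U r2"
    unfolding p1_def q1_def r1_def p2_def q2_def r2_def
    by (intro smooth_intros k J J_nonzero; assumption)+
qed

lemmas partials_christoffel = smooth_christoffel[THEN smooth_on_partials]

text \<open>By Cramer's rule the six symbols solve the transformation law of Christoffel symbols:
  second derivatives of the map are the pulled-back symbols applied to first derivatives, minus the
  target symbols on pairs of first derivatives. The nonzero target symbols have upper index 2, so X
  gets no correction and Y gets the terms in \<pi> and \<rho>.\<close>

lemma partials_a: "partials U a (\<lambda>z. p1 z * a z + p2 z * b z) (\<lambda>z. q1 z * a z + q2 z * b z)"
  by (rule partials_eqI[OF smooth_on_partials[OF smooth_on_pdx[OF smooth_X]]])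
    (use J_nonzero in \<open>auto simp: p1_def p2_def q1_def q2_def divide_simps\<close>;
      auto simp: J_def algebra_simps)+

lemma partials_b: "partials U b (\<lambda>z. q1 z * a z + q2 z * b z) (\<lambda>z. r1 z * a z + r2 z * b z)"
  by (rule partials_eqI[OF smooth_on_partials[OF smooth_on_pdy[OF smooth_X]]])
    (use J_nonzero in \<open>auto simp: smooth_on_pdx_pdy[OF smooth_X open_U]
        r1_def r2_def q1_def q2_def divide_simps\<close>;
      auto simp: J_def algebra_simps)+

lemma partials_c: "partials U c
   (\<lambda>z. p1 z * c z + p2 z * d z + \<pi> z * a z ^ 2 + \<rho> z * c z ^ 2)
   (\<lambda>z. q1 z * c z + q2 z * d z + \<pi> z * a z * b z + \<rho> z * c z * d z)"
proof (rule partials_eqI[OF smooth_on_partials[OF smooth_on_pdx[OF smooth_Y]]])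
  fix z assume z: "z \<in> U"
  have "kxx z = p1 z * c z + p2 z * d z" "kxy z = q1 z * c z + q2 z * d z"
    using J_nonzero[OF z] unfolding p1_def p2_def q1_def q2_def
    by (simp_all add: divide_simps) (simp_all add: J_def algebra_simps)
  then show "pdx c z = p1 z * c z + p2 z * d z + \<pi> z * a z ^ 2 + \<rho> z * c z ^ 2"
    "pdy c z = q1 z * c z + q2 z * d z + \<pi> z * a z * b z + \<rho> z * c z * d z"
    by (auto simp: kxx_def kxy_def algebra_simps)
qed

lemma partials_d: "partials U d
   (\<lambda>z. q1 z * c z + q2 z * d z + \<pi> z * a z * b z + \<rho> z * c z * d z)
   (\<lambda>z. r1 z * c z + r2 z * d z + \<pi> z * b z ^ 2 + \<rho> z * d z ^ 2)"
proof (rule partials_eqI[OF smooth_on_partials[OF smooth_on_pdy[OF smooth_Y]]])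
  fix z assume z: "z \<in> U"
  have "kyy z = r1 z * c z + r2 z * d z" "kxy z = q1 z * c z + q2 z * d z"
    using J_nonzero[OF z] unfolding r1_def r2_def q1_def q2_def
    by (simp_all add: divide_simps) (simp_all add: J_def algebra_simps)
  then show "pdx d z = q1 z * c z + q2 z * d z + \<pi> z * a z * b z + \<rho> z * c z * d z"
    "pdy d z = r1 z * c z + r2 z * d z + \<pi> z * b z ^ 2 + \<rho> z * d z ^ 2"
    using smooth_on_pdx_pdy[OF smooth_Y open_U z]
    by (auto simp: kyy_def kxy_def algebra_simps)
qed

text \<open>The logarithmic derivative of J is the trace of the pulled-back connection minus that of
  the target connection, whose trace in the Y direction is -\<rho>.\<close>

lemma partials_J: "partials U J
   (\<lambda>z. J z * (p1 z + q2 z + \<rho> z * c z)) (\<lambda>z. J z * (q1 z + r2 z + \<rho> z * d z))"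
  unfolding J_def
  by (rule partials_eqI, (rule partials_intros partials_a partials_b partials_c partials_d)+)
    (simp_all add: algebra_simps power2_eq_square)

lemma partials_X: "partials U X a b"
  using smooth_on_partials[OF smooth_X] .

lemma partials_\<pi>: "partials U \<pi> (\<lambda>z. \<pi>X z * a z + \<pi>Y z * c z) (\<lambda>z. \<pi>X z * b z + \<pi>Y z * d z)"
  unfolding \<pi>_def \<pi>X_def \<pi>Y_def
  by (rule partials_eqI, (rule partials_intros partials_X partials_s open_U | (simp add: s_nonzero; fail))+)
    (use s_nonzero in \<open>auto simp: field_simps power2_eq_square power3_eq_cube\<close>)

lemma partials_\<rho>: "partials U \<rho> (\<lambda>z. \<rho>' z * c z) (\<lambda>z. \<rho>' z * d z)"
  unfolding \<rho>_def \<rho>'_def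
  by (rule partials_eqI, (rule partials_intros partials_X partials_s open_U | (simp add: s_nonzero; fail))+)

text \<open>For the target coefficients (\<pi>, 0, \<rho>/3, 0) the formula for A collapses to the
  Y-derivative of \<open>\<pi>Y - \<rho> * \<pi>\<close>, so \<alpha> is the Y-derivative of the
  curvature.\<close>

lemma partials_\<kappa>: "partials U \<kappa> (\<lambda>z. \<kappa>X * a z + \<alpha> z * c z) (\<lambda>z. \<kappa>X * b z + \<alpha> z * d z)"
  unfolding \<kappa>_def \<kappa>X_def \<alpha>_def
  by (rule partials_eqI, (rule partials_intros partials_X partials_s open_U | (simp add: s_nonzero; fail))+)
    (use s_nonzero in \<open>auto simp: field_simps eval_nat_numeral\<close>)

lemma \<kappa>_eq: "z \<in> U \<Longrightarrow> \<kappa> z = \<pi>Y z - \<rho> z * \<pi> z"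
  using s_nonzero by (auto simp: \<kappa>_def \<pi>Y_def \<rho>_def \<pi>_def field_simps eval_nat_numeral)

text \<open>
  Symmetry of the third derivatives of X and Y: the curvature of the pullback is the pullback of
  the curvature.
\<close>

lemma curvature:
  assumes z: "z \<in> U"
  shows "pdy p1 z - pdx q1 z + p2 z * r1 z - q2 z * q1 z = \<kappa> z * a z * b z" (is ?A)
    "pdy p2 z - pdx q2 z + p1 z * q2 z + p2 z * r2 z - q1 z * p2 z - q2 z * q2 z = - (\<kappa> z * a z * a z)" (is ?B)
    "pdy q1 z - pdx r1 z + q1 z * q1 z + q2 z * r1 z - r1 z * p1 z - r2 z * q1 z = \<kappa> z * b z * b z" (is ?C)
    "pdy q2 z - pdx r2 z + q1 z * q2 z - r1 z * p2 z = - (\<kappa> z * b z * a z)" (is ?D)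
proof -
  note [simp] = algebra_simps power2_eq_square
  note pm = partials_mult and pa = partials_add and g = partials_christoffel
  note a = partials_a and b = partials_b and c = partials_c and d = partials_d
  note mixed = partials_mixed[OF _ open_U _ _ _ z]
  note X1 = mixed[OF smooth_on_pdx[OF smooth_X] a pa[OF pm[OF g(1) a] pm[OF g(4) b]]
      pa[OF pm[OF g(2) a] pm[OF g(5) b]]]
  note X2 = mixed[OF smooth_on_pdy[OF smooth_X] b pa[OF pm[OF g(2) a] pm[OF g(5) b]]
      pa[OF pm[OF g(3) a] pm[OF g(6) b]]]
  note cx = pa[OF pa[OF pa[OF pm[OF g(1) c] pm[OF g(4) d]] pm[OF partials_\<pi> partials_power[OF a, where n=2]]]
      pm[OF partials_\<rho> partials_power[OF c, where n=2]]]
  note cy = pa[OF pa[OF pa[OF pm[OF g(2) c] pm[OF g(5) d]] pm[OF pm[OF partials_\<pi> a] b]]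
      pm[OF pm[OF partials_\<rho> c] d]]
  note dy = pa[OF pa[OF pa[OF pm[OF g(3) c] pm[OF g(6) d]] pm[OF partials_\<pi> partials_power[OF b, where n=2]]]
      pm[OF partials_\<rho> partials_power[OF d, where n=2]]]
  note Y1 = mixed[OF smooth_on_pdx[OF smooth_Y] c cx cy]
  note Y2 = mixed[OF smooth_on_pdy[OF smooth_Y] d cy dy]
  have J: "a z * d z - b z * c z \<noteq> 0" using J_nonzero[OF z] by (simp add: J_def)
  \<comment> \<open>Symmetry for X_x and Y_x gives two linear equations for two curvature
    components, with matrix (a b; c d) of determinant J; symmetry for X_y and Y_y gives the other
    two.\<close>
  have 1: "a z * (pdy p1 z - pdx q1 z + p2 z * r1 z - q2 z * q1 z) +
      b z * (pdy p2 z - pdx q2 z + p1 z * q2 z + p2 z * r2 z - q1 z * p2 z - q2 z * q2 z) = 0"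
    using X1 by simp
  have 2: "c z * (pdy p1 z - pdx q1 z + p2 z * r1 z - q2 z * q1 z) +
      d z * (pdy p2 z - pdx q2 z + p1 z * q2 z + p2 z * r2 z - q1 z * p2 z - q2 z * q2 z)
      = - (\<kappa> z * a z * (a z * d z - b z * c z))"
    using Y1 by (simp add: \<kappa>_eq[OF z])
  have 3: "a z * (pdy q1 z - pdx r1 z + q1 z * q1 z + q2 z * r1 z - r1 z * p1 z - r2 z * q1 z) +
      b z * (pdy q2 z - pdx r2 z + q1 z * q2 z - r1 z * p2 z) = 0"
    using X2 by simp
  have 4: "c z * (pdy q1 z - pdx r1 z + q1 z * q1 z + q2 z * r1 z - r1 z * p1 z - r2 z * q1 z) +
      d z * (pdy q2 z - pdx r2 z + q1 z * q2 z - r1 z * p2 z)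
      = - (\<kappa> z * b z * (a z * d z - b z * c z))"
    using Y2 by (simp add: \<kappa>_eq[OF z])
  show ?A ?B ?C ?D
    using solve_curvature[OF 1 2 J] solve_curvature[OF 3 4 J] by blast+
qed

end

subsection \<open>Transformation laws of the pseudoinvariants\<close>

lemma partials_eq_on:
  assumes "\<And>z. z \<in> U \<Longrightarrow> f z = g z" "partials U f fx fy" "partials U g gx gy" "open U" "z \<in> U"
  shows "fx z = gx z" "fy z = gy z"
proof -
  have "partials U f gx gy"
    by (rule partials_cong[OF assms(3,4,1)]) auto
  then show "fx z = gx z" "fy z = gy z"
    using partials_unique[OF assms(2) _ assms(5)] by auto
qed

text \<open>Unparametrised geodesics of the pullback satisfy y'' = -p2 + (p1 - 2 q2) y' + (2 q1 -
  r2) y'^2 + r1 y'^3. The assumptions identify (E) with this equation.\<close>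

locale p34_pullback = cubic_ode P Q R S + p34_transformation U X Y s \<beta>
  for P Q R S :: "'a::real_normed_field \<times> 'a \<Rightarrow> 'a" and U :: "('a \<times> 'a) set"
    and X Y s :: "'a \<times> 'a \<Rightarrow> 'a" and \<beta> :: 'a +
  assumes P: "z \<in> U \<Longrightarrow> P z = - p2 z"
    and Q: "z \<in> U \<Longrightarrow> Q z = (p1 z - 2 * q2 z) / 3"
    and R: "z \<in> U \<Longrightarrow> R z = (2 * q1 z - r2 z) / 3"
    and S: "z \<in> U \<Longrightarrow> S z = r1 z"
begin

lemma partials_P: "partials U P (\<lambda>z. - pdx p2 z) (\<lambda>z. - pdy p2 z)"
  by (rule partials_cong[OF partials_minus[OF partials_christoffel(4)] open_U]) (simp_all add: P)

lemma partials_Q: "partials U Q (\<lambda>z. (pdx p1 z - 2 * pdx q2 z) / 3) (\<lambda>z. (pdy p1 z - 2 * pdy q2 z) / 3)"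
  by (rule partials_cong[OF partials_cmult[OF partials_diff[OF partials_christoffel(1)
          partials_cmult[OF partials_christoffel(5)]], of "1 / 3" 2] open_U])
    (simp_all add: Q)

lemma partials_R: "partials U R (\<lambda>z. (2 * pdx q1 z - pdx r2 z) / 3) (\<lambda>z. (2 * pdy q1 z - pdy r2 z) / 3)"
  by (rule partials_cong[OF partials_cmult[OF partials_diff[OF partials_cmult[OF partials_christoffel(2)]
          partials_christoffel(6)], of "1 / 3" 2] open_U])
    (simp_all add: R)

lemma partials_S: "partials U S (pdx r1) (pdy r1)"
  by (rule partials_cong[OF partials_christoffel(3) open_U]) (simp_all add: S)

lemmas partials_pdx_christoffel = smooth_christoffel[THEN smooth_on_pdx, THEN smooth_on_partials]
lemmas partials_pdy_christoffel = smooth_christoffel[THEN smooth_on_pdy, THEN smooth_on_partials]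

lemma pd_coefficients:
  assumes z: "z \<in> U"
  shows "pd 1 0 P z = - pdx p2 z" "pd 0 1 P z = - pdy p2 z" "pd 0 2 P z = - pdy (pdy p2) z"
    "pd 1 0 Q z = (pdx p1 z - 2 * pdx q2 z) / 3" "pd 0 1 Q z = (pdy p1 z - 2 * pdy q2 z) / 3"
    "pd 1 1 Q z = (pdx (pdy p1) z - 2 * pdx (pdy q2) z) / 3"
    "pd 0 2 Q z = (pdy (pdy p1) z - 2 * pdy (pdy q2) z) / 3"
    "pd 1 0 R z = (2 * pdx q1 z - pdx r2 z) / 3" "pd 0 1 R z = (2 * pdy q1 z - pdy r2 z) / 3"
    "pd 1 1 R z = (2 * pdx (pdy q1) z - pdx (pdy r2) z) / 3"
    "pd 2 0 R z = (2 * pdx (pdx q1) z - pdx (pdx r2) z) / 3"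
    "pd 1 0 S z = pdx r1 z" "pd 0 1 S z = pdy r1 z" "pd 2 0 S z = pdx (pdx r1) z"
proof -
  have Py: "partials U (pdy P) (\<lambda>z. - pdx (pdy p2) z) (\<lambda>z. - pdy (pdy p2) z)"
    by (rule partials_cong[OF partials_minus[OF partials_pdy_christoffel(4)] open_U])
      (simp_all add: partials_pdy[OF partials_P])
  have Qy: "partials U (pdy Q) (\<lambda>z. (pdx (pdy p1) z - 2 * pdx (pdy q2) z) / 3)
      (\<lambda>z. (pdy (pdy p1) z - 2 * pdy (pdy q2) z) / 3)"
    by (rule partials_cong[OF partials_cmult[OF partials_diff[OF partials_pdy_christoffel(1)
          partials_cmult[OF partials_pdy_christoffel(5)]], of "1 / 3" 2] open_U])
      (simp_all add: partials_pdy[OF partials_Q])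
  have Ry: "partials U (pdy R) (\<lambda>z. (2 * pdx (pdy q1) z - pdx (pdy r2) z) / 3)
      (\<lambda>z. (2 * pdy (pdy q1) z - pdy (pdy r2) z) / 3)"
    by (rule partials_cong[OF partials_cmult[OF partials_diff[OF partials_cmult[OF partials_pdy_christoffel(2)]
          partials_pdy_christoffel(6)], of "1 / 3" 2] open_U])
      (simp_all add: partials_pdy[OF partials_R])
  have Rx: "partials U (pdx R) (\<lambda>z. (2 * pdx (pdx q1) z - pdx (pdx r2) z) / 3)
      (\<lambda>z. (2 * pdy (pdx q1) z - pdy (pdx r2) z) / 3)"
    by (rule partials_cong[OF partials_cmult[OF partials_diff[OF partials_cmult[OF partials_pdx_christoffel(2)]
          partials_pdx_christoffel(6)], of "1 / 3" 2] open_U])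
      (simp_all add: partials_pdx[OF partials_R])
  have Sx: "partials U (pdx S) (pdx (pdx r1)) (pdy (pdx r1))"
    by (rule partials_cong[OF partials_pdx_christoffel(3) open_U])
      (simp_all add: partials_pdx[OF partials_S])
  show "pd 1 0 P z = - pdx p2 z" "pd 0 1 P z = - pdy p2 z" "pd 0 2 P z = - pdy (pdy p2) z"
    "pd 1 0 Q z = (pdx p1 z - 2 * pdx q2 z) / 3" "pd 0 1 Q z = (pdy p1 z - 2 * pdy q2 z) / 3"
    "pd 1 1 Q z = (pdx (pdy p1) z - 2 * pdx (pdy q2) z) / 3"
    "pd 0 2 Q z = (pdy (pdy p1) z - 2 * pdy (pdy q2) z) / 3"
    "pd 1 0 R z = (2 * pdx q1 z - pdx r2 z) / 3" "pd 0 1 R z = (2 * pdy q1 z - pdy r2 z) / 3"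
    "pd 1 1 R z = (2 * pdx (pdy q1) z - pdx (pdy r2) z) / 3"
    "pd 2 0 R z = (2 * pdx (pdx q1) z - pdx (pdx r2) z) / 3"
    "pd 1 0 S z = pdx r1 z" "pd 0 1 S z = pdy r1 z" "pd 2 0 S z = pdx (pdx r1) z"
    unfolding pd_def
    using partials_pdx[OF partials_P z] partials_pdy[OF partials_P z] partials_pdy[OF Py z]
      partials_pdx[OF partials_Q z] partials_pdy[OF partials_Q z] partials_pdx[OF Qy z] partials_pdy[OF Qy z]
      partials_pdx[OF partials_R z] partials_pdy[OF partials_R z] partials_pdx[OF Ry z] partials_pdx[OF Rx z]
      partials_pdx[OF partials_S z] partials_pdy[OF partials_S z] partials_pdx[OF Sx z]
    by (simp_all add: eval_nat_numeral)
qed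

lemma curvature_solved:
  assumes "z \<in> U"
  shows "pdy p1 z = pdx q1 z - p2 z * r1 z + q2 z * q1 z + \<kappa> z * a z * b z"
    "pdy p2 z = pdx q2 z - p1 z * q2 z - p2 z * r2 z + q1 z * p2 z + q2 z * q2 z - \<kappa> z * a z * a z"
    "pdy q1 z = pdx r1 z - q1 z * q1 z - q2 z * r1 z + r1 z * p1 z + r2 z * q1 z + \<kappa> z * b z * b z"
    "pdy q2 z = pdx r2 z - q1 z * q2 z + r1 z * p2 z - \<kappa> z * b z * a z"
  using curvature[OF assms] by (simp_all add: algebra_simps)

text \<open>
  The second derivatives of P, Q, R, S occur in A and B only through first derivatives of the
  curvature, which is known in closed form.
\<close>

lemma A_B_eq:
  assumes z: "z \<in> U"
  shows "A z = \<alpha> z * J z * a z" "B z = \<alpha> z * J z * b z"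
proof -
  note pm = partials_mult and pa = partials_add and ps = partials_diff and g = partials_christoffel
    and gx = partials_pdx_christoffel and gy = partials_pdy_christoffel
  note a = partials_a and b = partials_b and k = partials_\<kappa>
  note e11 = partials_eq_on[OF curvature(1) ps[OF pa[OF ps[OF gy(1) gx(2)] pm[OF g(4) g(3)]] pm[OF g(5) g(2)]]
     pm[OF pm[OF k a] b] open_U z]
  note e21 = partials_eq_on[OF curvature(2) ps[OF ps[OF pa[OF pa[OF ps[OF gy(4) gx(5)] pm[OF g(1) g(5)]]
     pm[OF g(4) g(6)]] pm[OF g(2) g(4)]] pm[OF g(5) g(5)]]
     partials_minus[OF pm[OF pm[OF k a] a]] open_U z]
  note e12 = partials_eq_on[OF curvature(3) ps[OF ps[OF pa[OF pa[OF ps[OF gy(2) gx(3)] pm[OF g(2) g(2)]]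
     pm[OF g(5) g(3)]] pm[OF g(3) g(1)]] pm[OF g(6) g(2)]]
     pm[OF pm[OF k b] b] open_U z]
  note e22 = partials_eq_on[OF curvature(4) ps[OF pa[OF ps[OF gy(5) gx(6)] pm[OF g(2) g(5)]] pm[OF g(3) g(4)]]
     partials_minus[OF pm[OF pm[OF k b] a]] open_U z]
  note clairaut = smooth_christoffel[THEN smooth_on_pdx_pdy[OF _ open_U z], symmetric]
  have A: "pdx (pdy p1) z - pdx (pdx q1) z = - (pdx p2 z * r1 z + p2 z * pdx r1 z - pdx q2 z * q1 z - q2 z * pdx q1 z)
     + (((\<kappa>X * a z + \<alpha> z * c z) * a z + \<kappa> z * (p1 z * a z + p2 z * b z)) * b z + \<kappa> z * a z * (q1 z * a z + q2 z * b z))"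
   "pdy (pdy p2) z - pdx (pdy q2) z = - (pdy p1 z * q2 z + p1 z * pdy q2 z + pdy p2 z * r2 z + p2 z * pdy r2 z
      - pdy q1 z * p2 z - q1 z * pdy p2 z - 2 * q2 z * pdy q2 z)
     - (((\<kappa>X * b z + \<alpha> z * d z) * a z + \<kappa> z * (q1 z * a z + q2 z * b z)) * a z + \<kappa> z * a z * (q1 z * a z + q2 z * b z))"
   "pdx (pdy q2) z - pdx (pdx r2) z = - (pdx q1 z * q2 z + q1 z * pdx q2 z - pdx r1 z * p2 z - r1 z * pdx p2 z)
     - (((\<kappa>X * a z + \<alpha> z * c z) * b z + \<kappa> z * (q1 z * a z + q2 z * b z)) * a z + \<kappa> z * b z * (p1 z * a z + p2 z * b z))"
    using e11(1) e21(2) e22(1) clairaut by (simp_all add: algebra_simps)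
  have B: "pdx (pdy q1) z - pdx (pdx r1) z = - (2 * q1 z * pdx q1 z + pdx q2 z * r1 z + q2 z * pdx r1 z
      - pdx r1 z * p1 z - r1 z * pdx p1 z - pdx r2 z * q1 z - r2 z * pdx q1 z)
     + (((\<kappa>X * a z + \<alpha> z * c z) * b z + \<kappa> z * (q1 z * a z + q2 z * b z)) * b z + \<kappa> z * b z * (q1 z * a z + q2 z * b z))"
   "pdy (pdy p1) z - pdx (pdy q1) z = - (pdy p2 z * r1 z + p2 z * pdy r1 z - pdy q2 z * q1 z - q2 z * pdy q1 z)
     + (((\<kappa>X * b z + \<alpha> z * d z) * a z + \<kappa> z * (q1 z * a z + q2 z * b z)) * b z + \<kappa> z * a z * (r1 z * a z + r2 z * b z))"
   "pdy (pdy q2) z - pdx (pdy r2) z = - (pdy q1 z * q2 z + q1 z * pdy q2 z - pdy r1 z * p2 z - r1 z * pdy p2 z)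
     - (((\<kappa>X * b z + \<alpha> z * d z) * b z + \<kappa> z * (r1 z * a z + r2 z * b z)) * a z + \<kappa> z * b z * (q1 z * a z + q2 z * b z))"
    using e12(1) e11(2) e22(2) clairaut by (simp_all add: algebra_simps)
  note sub = P[OF z] Q[OF z] R[OF z] S[OF z] pd_coefficients[OF z]
  \<comment> \<open>The second derivatives are grouped into the three differences known from the
    differentiated curvature equations; for this the mixed derivative of q2, with coefficient 4/3,
    is split as 1 + 1/3.\<close>
  have "A z = - (pdy (pdy p2) z - pdx (pdy q2) z) - 2 / 3 * (pdx (pdy p1) z - pdx (pdx q1) z)
     + (pdx (pdy q2) z - pdx (pdx r2) z) / 3 - 2 * p2 z * pdx r1 z - r1 z * pdx p2 z
     + p2 z * (2 * pdy q1 z - pdy r2 z) + (2 * q1 z - r2 z) * pdy p2 z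
     - (p1 z - 2 * q2 z) * (2 * pdx q1 z - pdx r2 z) / 3
     + 2 * (p1 z - 2 * q2 z) * (pdy p1 z - 2 * pdy q2 z) / 3"
    unfolding A_def sub by (simp add: field_simps)
  \<comment> \<open>The terms in \<open>\<kappa>X\<close> carry the coefficients -2/3, 1, -1/3 and
    cancel; those in \<alpha> combine to \<alpha> a (a d - b c).\<close>
  also have "\<dots> = \<alpha> z * J z * a z"
    unfolding A unfolding curvature_solved[OF z] J_def by (simp add: field_simps)
  finally show "A z = \<alpha> z * J z * a z" .
  have "B z = - (pdx (pdy q1) z - pdx (pdx r1) z) + (pdy (pdy p1) z - pdx (pdy q1) z) / 3
     - 2 / 3 * (pdy (pdy q2) z - pdx (pdy r2) z) + 2 * r1 z * pdy p2 z + p2 z * pdy r1 z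
     + r1 z * (pdx p1 z - 2 * pdx q2 z) + (p1 z - 2 * q2 z) * pdx r1 z
     + (2 * q1 z - r2 z) * (pdy p1 z - 2 * pdy q2 z) / 3
     - 2 * (2 * q1 z - r2 z) * (2 * pdx q1 z - pdx r2 z) / 3"
    unfolding B_def sub by (simp add: field_simps)
  also have "\<dots> = \<alpha> z * J z * b z"
    unfolding B unfolding curvature_solved[OF z] J_def by (simp add: field_simps)
  finally show "B z = \<alpha> z * J z * b z" .
qed

end

text \<open>Here t is B / A, and x, y, xx are derivatives of A divided by A, the primed letters
  those of B divided by A. All powers of A cancel, and this is done over bare variables before the
  symbols are substituted.\<close>

lemma scaled_Omega_A:
  fixes A :: "'a::field"
  assumes "A \<noteq> 0"
  shows "2 * (t * A) * (A * x) * (t * A * P + A * x) / A ^ 3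
     - (2 * (A * x') + 3 * (t * A) * Q) * (A * x) / A ^ 2
     + (A * y - 2 * (A * x')) * (t * A) * P / A ^ 2
     - (t * A * (A * xx) + (t * A) ^ 2 * Px) / A ^ 2
     + A * xx' / A
     + (3 * (A * x') * Q + 3 * (t * A) * Qx - A * y' * P - t * A * Py) / A + Qy - 2 * Rx
   = 2 * t * x * (t * P + x) - (2 * x' + 3 * t * Q) * x + (y - 2 * x') * t * P
     - (t * xx + t ^ 2 * Px) + xx' + (3 * x' * Q + 3 * t * Qx - y' * P - t * Py) + Qy - 2 * Rx"
  using assms by (simp add: field_simps eval_nat_numeral)

lemma scaled_Omega_B:
  fixes B :: "'a::field"
  assumes "B \<noteq> 0"
  shows "2 * (t * B) * (B * y') * (t * B * S - B * y') / B ^ 3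
     + (2 * (B * y) - 3 * (t * B) * R) * (B * y') / B ^ 2
     + (B * x' - 2 * (B * y)) * (t * B) * S / B ^ 2
     + (t * B * (B * yy') - (t * B) ^ 2 * Sy) / B ^ 2
     - B * yy / B
     + (3 * (B * y) * R + 3 * (t * B) * Ry - B * x * S - t * B * Sx) / B + Rx - 2 * Qy
   = 2 * t * y' * (t * S - y') + (2 * y - 3 * t * R) * y' + (x' - 2 * y) * t * S
     + (t * yy' - t ^ 2 * Sy) - yy + (3 * y * R + 3 * t * Ry - x * S - t * Sx) + Rx - 2 * Qy"
  using assms by (simp add: field_simps eval_nat_numeral)

context p34_pullback
begin

text \<open>
  \<nu>, \<mu> and (g, 0) are the values of N, M and (gamma1, gamma2) for the target equation, where B = 0;
  the values for the given equation carry the weights 2, 4 and 3 in the Jacobian J.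
\<close>

definition \<alpha>Y where "\<alpha>Y z = \<beta> ^ 2 * (4 * s z ^ 3 + 5) / (6 * s z ^ 8)"
definition \<eta> where "\<eta> z = \<alpha> z * J z"
definition \<nu> where "\<nu> z = \<beta> ^ 2 * (5 - 2 * s z ^ 3) / (36 * s z ^ 8)"
definition \<nu>Y where "\<nu>Y z = \<beta> ^ 2 * (5 * s z ^ 3 - 20) / (54 * s z ^ 11)"
definition \<mu> where "\<mu> z = \<beta> ^ 4 * (2 * s z ^ 3 - 35) / (180 * s z ^ 13)"
definition g where "g z = - (\<beta> ^ 2 * (2 * s z ^ 3 - 35) / (90 * (2 * s z ^ 3 + 1) * s z ^ 8))"

lemma smooth_\<alpha>: "smooth_on U \<alpha>"
  unfolding \<alpha>_def by (intro smooth_intros) (simp add: s_nonzero)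

lemma smooth_J: "smooth_on U J"
  unfolding J_def by (intro smooth_intros)

lemma smooth_\<eta>: "smooth_on U \<eta>"
  unfolding \<eta>_def by (intro smooth_intros smooth_\<alpha> smooth_J)

lemma partials_\<alpha>: "partials U \<alpha> (\<lambda>z. \<alpha>Y z * c z) (\<lambda>z. \<alpha>Y z * d z)"
  unfolding \<alpha>_def \<alpha>Y_def
  by (rule partials_eqI, (rule partials_intros partials_s open_U | (simp add: s_nonzero; fail))+)
    (use s_nonzero in \<open>auto simp: field_simps eval_nat_numeral\<close>)

lemma partials_\<nu>: "partials U \<nu> (\<lambda>z. \<nu>Y z * c z) (\<lambda>z. \<nu>Y z * d z)"
  unfolding \<nu>_def \<nu>Y_def
  by (rule partials_eqI, (rule partials_intros partials_s open_U | (simp add: s_nonzero; fail))+)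
    (use s_nonzero in \<open>auto simp: field_simps eval_nat_numeral\<close>)

text \<open>N evaluated for the target from the first set of formulas, with B = 0 and coefficients
  (\<pi>, 0, \<rho>/3, 0); \<open>\<mu>_eq\<close> is the same evaluation of M.\<close>

lemma \<nu>_eq: "z \<in> U \<Longrightarrow> \<alpha>Y z + \<rho> z * \<alpha> z = 3 * \<nu> z"
  using s_nonzero by (auto simp: \<alpha>Y_def \<rho>_def \<alpha>_def \<nu>_def field_simps eval_nat_numeral)

lemma \<mu>_eq: "z \<in> U \<Longrightarrow> \<mu> z = 6 / 5 * \<nu> z * \<alpha>Y z - \<alpha> z * \<nu>Y z - 4 / 5 * \<alpha> z * \<rho> z * \<nu> z"
  using s_nonzero
  by (auto simp: \<alpha>Y_def \<rho>_def \<alpha>_def \<nu>_def \<mu>_def \<nu>Y_def field_simps eval_nat_numeral)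

lemma pdx_\<eta>: "z \<in> U \<Longrightarrow> pdx \<eta> z = J z * (\<alpha>Y z * c z + \<alpha> z * (p1 z + q2 z + \<rho> z * c z))"
  unfolding \<eta>_def using partials_pdx[OF partials_mult[OF partials_\<alpha> partials_J]]
  by (simp add: algebra_simps)

lemma pdy_\<eta>: "z \<in> U \<Longrightarrow> pdy \<eta> z = J z * (\<alpha>Y z * d z + \<alpha> z * (q1 z + r2 z + \<rho> z * d z))"
  unfolding \<eta>_def using partials_pdy[OF partials_mult[OF partials_\<alpha> partials_J]]
  by (simp add: algebra_simps)

lemma A_eq: "z \<in> U \<Longrightarrow> A z = \<eta> z * a z"
  and B_eq: "z \<in> U \<Longrightarrow> B z = \<eta> z * b z"
  by (simp_all add: A_B_eq \<eta>_def)

lemma partials_A: "partials U A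
    (\<lambda>z. pdx \<eta> z * a z + \<eta> z * (p1 z * a z + p2 z * b z))
    (\<lambda>z. pdy \<eta> z * a z + \<eta> z * (q1 z * a z + q2 z * b z))"
  by (rule partials_cong[OF partials_mult[OF smooth_on_partials[OF smooth_\<eta>] partials_a] open_U])
    (simp_all add: A_eq)

lemma partials_B: "partials U B
    (\<lambda>z. pdx \<eta> z * b z + \<eta> z * (q1 z * a z + q2 z * b z))
    (\<lambda>z. pdy \<eta> z * b z + \<eta> z * (r1 z * a z + r2 z * b z))"
  by (rule partials_cong[OF partials_mult[OF smooth_on_partials[OF smooth_\<eta>] partials_b] open_U])
    (simp_all add: B_eq)

lemmas partials_pdx_\<eta> = smooth_on_partials[OF smooth_on_pdx[OF smooth_\<eta>]]
lemmas partials_pdy_\<eta> = smooth_on_partials[OF smooth_on_pdy[OF smooth_\<eta>]]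
lemmas partials_\<eta> = smooth_on_partials[OF smooth_\<eta>]

lemma pd_A_B:
  assumes z: "z \<in> U"
  shows "pd 1 0 A z = pdx \<eta> z * a z + \<eta> z * (p1 z * a z + p2 z * b z)"
    "pd 0 1 A z = pdy \<eta> z * a z + \<eta> z * (q1 z * a z + q2 z * b z)"
    "pd 1 0 B z = pdx \<eta> z * b z + \<eta> z * (q1 z * a z + q2 z * b z)"
    "pd 0 1 B z = pdy \<eta> z * b z + \<eta> z * (r1 z * a z + r2 z * b z)"
    "pd 2 0 A z = pdx (pdx \<eta>) z * a z + 2 * pdx \<eta> z * (p1 z * a z + p2 z * b z)
      + \<eta> z * (pdx p1 z * a z + p1 z * (p1 z * a z + p2 z * b z)
         + pdx p2 z * b z + p2 z * (q1 z * a z + q2 z * b z))"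
    "pd 2 0 B z = pdx (pdx \<eta>) z * b z + 2 * pdx \<eta> z * (q1 z * a z + q2 z * b z)
      + \<eta> z * (pdx q1 z * a z + q1 z * (p1 z * a z + p2 z * b z)
         + pdx q2 z * b z + q2 z * (q1 z * a z + q2 z * b z))"
    "pd 0 2 A z = pdy (pdy \<eta>) z * a z + 2 * pdy \<eta> z * (q1 z * a z + q2 z * b z)
      + \<eta> z * (pdy q1 z * a z + q1 z * (q1 z * a z + q2 z * b z)
         + pdy q2 z * b z + q2 z * (r1 z * a z + r2 z * b z))"
    "pd 0 2 B z = pdy (pdy \<eta>) z * b z + 2 * pdy \<eta> z * (r1 z * a z + r2 z * b z)
      + \<eta> z * (pdy r1 z * a z + r1 z * (q1 z * a z + q2 z * b z)
         + pdy r2 z * b z + r2 z * (r1 z * a z + r2 z * b z))"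
proof -
  note pm = partials_mult and pa = partials_add and pg = partials_christoffel
  note cong = partials_cong[OF pa[OF pm[OF _ _] pm[OF partials_\<eta> pa[OF pm[OF _ _] pm[OF _ _]]]] open_U]
  note Ax = partials_pdx[OF cong[OF partials_pdx_\<eta> partials_a pg(1) partials_a pg(4) partials_b
        partials_pdx[OF partials_A] refl refl] z]
  note Ay = partials_pdy[OF cong[OF partials_pdy_\<eta> partials_a pg(2) partials_a pg(5) partials_b
        partials_pdy[OF partials_A] refl refl] z]
  note Bx = partials_pdx[OF cong[OF partials_pdx_\<eta> partials_b pg(2) partials_a pg(5) partials_b
        partials_pdx[OF partials_B] refl refl] z]
  note By = partials_pdy[OF cong[OF partials_pdy_\<eta> partials_b pg(3) partials_a pg(6) partials_b
        partials_pdy[OF partials_B] refl refl] z]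
  show "pd 1 0 A z = pdx \<eta> z * a z + \<eta> z * (p1 z * a z + p2 z * b z)"
    "pd 0 1 A z = pdy \<eta> z * a z + \<eta> z * (q1 z * a z + q2 z * b z)"
    "pd 1 0 B z = pdx \<eta> z * b z + \<eta> z * (q1 z * a z + q2 z * b z)"
    "pd 0 1 B z = pdy \<eta> z * b z + \<eta> z * (r1 z * a z + r2 z * b z)"
    using partials_pdx[OF partials_A z] partials_pdy[OF partials_A z]
      partials_pdx[OF partials_B z] partials_pdy[OF partials_B z]
    by (simp_all add: pd_def)
  show "pd 2 0 A z = pdx (pdx \<eta>) z * a z + 2 * pdx \<eta> z * (p1 z * a z + p2 z * b z)
      + \<eta> z * (pdx p1 z * a z + p1 z * (p1 z * a z + p2 z * b z)
         + pdx p2 z * b z + p2 z * (q1 z * a z + q2 z * b z))"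
    "pd 2 0 B z = pdx (pdx \<eta>) z * b z + 2 * pdx \<eta> z * (q1 z * a z + q2 z * b z)
      + \<eta> z * (pdx q1 z * a z + q1 z * (p1 z * a z + p2 z * b z)
         + pdx q2 z * b z + q2 z * (q1 z * a z + q2 z * b z))"
    "pd 0 2 A z = pdy (pdy \<eta>) z * a z + 2 * pdy \<eta> z * (q1 z * a z + q2 z * b z)
      + \<eta> z * (pdy q1 z * a z + q1 z * (q1 z * a z + q2 z * b z)
         + pdy q2 z * b z + q2 z * (r1 z * a z + r2 z * b z))"
    "pd 0 2 B z = pdy (pdy \<eta>) z * b z + 2 * pdy \<eta> z * (r1 z * a z + r2 z * b z)
      + \<eta> z * (pdy r1 z * a z + r1 z * (q1 z * a z + q2 z * b z)
         + pdy r2 z * b z + r2 z * (r1 z * a z + r2 z * b z))"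
    using Ax Ay Bx By
    by (simp_all add: pd_def numeral_2_eq_2 algebra_simps)
qed

text \<open>Both reduce to the derivative of \<eta> along (-b, a), a field that annihilates X and
  sends Y to J; the traces \<open>p1 + q2\<close> and \<open>q1 + r2\<close> cancel against those in
  the derivatives of J. Consequently A G + B H = 0, which is F = 0, and the two formulas for N
  agree.\<close>

lemma GH_eq:
  assumes z: "z \<in> U"
  shows "G z = 3 * B z * (J z ^ 2 * \<nu> z)" "H z = - (3 * A z * (J z ^ 2 * \<nu> z))"
proof -
  note sub = P[OF z] Q[OF z] R[OF z] S[OF z] pd_A_B[OF z] A_eq[OF z] B_eq[OF z]
  have \<nu>: "3 * \<nu> z = \<alpha>Y z + \<rho> z * \<alpha> z" using \<nu>_eq[OF z] by simp
  have "G z = \<eta> z * b z * (a z * pdy \<eta> z - b z * pdx \<eta> z)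
     + \<eta> z * b z * \<eta> z * (b z * (p1 z + q2 z) - a z * (q1 z + r2 z))"
    unfolding G_def sub by (simp add: field_simps power2_eq_square)
  also have "\<dots> = \<eta> z * b z * J z ^ 2 * (\<alpha>Y z + \<rho> z * \<alpha> z)"
    unfolding pdx_\<eta>[OF z] pdy_\<eta>[OF z] unfolding \<eta>_def J_def
    by (simp add: algebra_simps power2_eq_square)
  finally show "G z = 3 * B z * (J z ^ 2 * \<nu> z)"
    unfolding \<nu>[symmetric] by (simp add: B_eq[OF z] mult_ac)
  have "H z = - (\<eta> z * a z * (a z * pdy \<eta> z - b z * pdx \<eta> z)
     + \<eta> z * a z * \<eta> z * (b z * (p1 z + q2 z) - a z * (q1 z + r2 z)))"
    unfolding H_def sub by (simp add: field_simps power2_eq_square)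
  also have "\<dots> = - (\<eta> z * a z * J z ^ 2 * (\<alpha>Y z + \<rho> z * \<alpha> z))"
    unfolding pdx_\<eta>[OF z] pdy_\<eta>[OF z] unfolding \<eta>_def J_def
    by (simp add: algebra_simps power2_eq_square)
  finally show "H z = - (3 * A z * (J z ^ 2 * \<nu> z))"
    unfolding \<nu>[symmetric] by (simp add: A_eq[OF z] mult_ac)
qed

lemma condition1_iff: "z \<in> U \<Longrightarrow> condition1 z \<longleftrightarrow> A z \<noteq> 0 \<or> B z \<noteq> 0"
  by (simp add: condition1_def F_value_def GH_eq)

lemma N_eq: "z \<in> U \<Longrightarrow> applies t z \<Longrightarrow> N t z = J z ^ 2 * \<nu> z"
  by (cases t) (simp_all add: GH_eq)

text \<open>
  With t = B / A and the logarithmic derivatives u, v of the common factor of A and B, everything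
  built from the first set of formulas becomes polynomial.
\<close>

lemma ratios_A:
  assumes z: "z \<in> U" "A z \<noteq> 0"
  obtains t u v l where "b z = t * a z"
    "pdx \<eta> z = u * \<eta> z" "pdy \<eta> z = v * \<eta> z" "B z = t * A z"
    "pd 1 0 A z = A z * (u + p1 z + p2 z * t)"
    "pd 0 1 A z = A z * (v + q1 z + q2 z * t)"
    "pd 1 0 B z = A z * (u * t + q1 z + q2 z * t)"
    "pd 0 1 B z = A z * (v * t + r1 z + r2 z * t)"
    "pd 2 0 A z = A z * (l + 2 * u * (p1 z + p2 z * t)
       + (pdx p1 z + p1 z * (p1 z + p2 z * t) + pdx p2 z * t + p2 z * (q1 z + q2 z * t)))"
    "pd 2 0 B z = A z * (l * t + 2 * u * (q1 z + q2 z * t)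
       + (pdx q1 z + q1 z * (p1 z + p2 z * t) + pdx q2 z * t + q2 z * (q1 z + q2 z * t)))"
proof
  have nz: "a z \<noteq> 0" "\<eta> z \<noteq> 0" using z by (auto simp: A_eq)
  show b: "b z = (b z / a z) * a z" and u: "pdx \<eta> z = (pdx \<eta> z / \<eta> z) * \<eta> z"
    and "pdy \<eta> z = (pdy \<eta> z / \<eta> z) * \<eta> z"
    using nz by simp_all
  show "pd 1 0 A z = A z * (pdx \<eta> z / \<eta> z + p1 z + p2 z * (b z / a z))"
    "pd 0 1 A z = A z * (pdy \<eta> z / \<eta> z + q1 z + q2 z * (b z / a z))"
    "pd 1 0 B z = A z * (pdx \<eta> z / \<eta> z * (b z / a z) + q1 z + q2 z * (b z / a z))"
    "pd 0 1 B z = A z * (pdy \<eta> z / \<eta> z * (b z / a z) + r1 z + r2 z * (b z / a z))"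
    "pd 2 0 A z = A z * (pdx (pdx \<eta>) z / \<eta> z + 2 * (pdx \<eta> z / \<eta> z) * (p1 z + p2 z * (b z / a z))
       + (pdx p1 z + p1 z * (p1 z + p2 z * (b z / a z)) + pdx p2 z * (b z / a z) + p2 z * (q1 z + q2 z * (b z / a z))))"
    "pd 2 0 B z = A z * (pdx (pdx \<eta>) z / \<eta> z * (b z / a z) + 2 * (pdx \<eta> z / \<eta> z) * (q1 z + q2 z * (b z / a z))
       + (pdx q1 z + q1 z * (p1 z + p2 z * (b z / a z)) + pdx q2 z * (b z / a z) + q2 z * (q1 z + q2 z * (b z / a z))))"
    "B z = b z / a z * A z"
    unfolding pd_A_B[OF z(1)] A_eq[OF z(1)] B_eq[OF z(1)] using nz by (simp_all add: field_simps)
qed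

lemma ratios_B:
  assumes z: "z \<in> U" "B z \<noteq> 0"
  obtains t u v l where "a z = t * b z"
    "pdx \<eta> z = u * \<eta> z" "pdy \<eta> z = v * \<eta> z" "A z = t * B z"
    "pd 1 0 A z = B z * (u * t + p1 z * t + p2 z)"
    "pd 0 1 A z = B z * (v * t + q1 z * t + q2 z)"
    "pd 1 0 B z = B z * (u + q1 z * t + q2 z)"
    "pd 0 1 B z = B z * (v + r1 z * t + r2 z)"
    "pd 0 2 A z = B z * (l * t + 2 * v * (q1 z * t + q2 z)
       + (pdy q1 z * t + q1 z * (q1 z * t + q2 z) + pdy q2 z + q2 z * (r1 z * t + r2 z)))"
    "pd 0 2 B z = B z * (l + 2 * v * (r1 z * t + r2 z)
       + (pdy r1 z * t + r1 z * (q1 z * t + q2 z) + pdy r2 z + r2 z * (r1 z * t + r2 z)))"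
proof
  have nz: "b z \<noteq> 0" "\<eta> z \<noteq> 0" using z by (auto simp: B_eq)
  show b: "a z = (a z / b z) * b z" and u: "pdx \<eta> z = (pdx \<eta> z / \<eta> z) * \<eta> z"
    and "pdy \<eta> z = (pdy \<eta> z / \<eta> z) * \<eta> z"
    using nz by simp_all
  show "pd 1 0 A z = B z * (pdx \<eta> z / \<eta> z * (a z / b z) + p1 z * (a z / b z) + p2 z)"
    "pd 0 1 A z = B z * (pdy \<eta> z / \<eta> z * (a z / b z) + q1 z * (a z / b z) + q2 z)"
    "pd 1 0 B z = B z * (pdx \<eta> z / \<eta> z + q1 z * (a z / b z) + q2 z)"
    "pd 0 1 B z = B z * (pdy \<eta> z / \<eta> z + r1 z * (a z / b z) + r2 z)"
    "pd 0 2 A z = B z * (pdy (pdy \<eta>) z / \<eta> z * (a z / b z) + 2 * (pdy \<eta> z / \<eta> z) * (q1 z * (a z / b z) + q2 z)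
       + (pdy q1 z * (a z / b z) + q1 z * (q1 z * (a z / b z) + q2 z) + pdy q2 z + q2 z * (r1 z * (a z / b z) + r2 z)))"
    "pd 0 2 B z = B z * (pdy (pdy \<eta>) z / \<eta> z + 2 * (pdy \<eta> z / \<eta> z) * (r1 z * (a z / b z) + r2 z)
       + (pdy r1 z * (a z / b z) + r1 z * (q1 z * (a z / b z) + q2 z) + pdy r2 z + r2 z * (r1 z * (a z / b z) + r2 z)))"
    "A z = a z / b z * B z"
    unfolding pd_A_B[OF z(1)] A_eq[OF z(1)] B_eq[OF z(1)] using nz by (simp_all add: field_simps)
qed

text \<open>The second derivative of \<eta> enters as -t l + l t and drops out. Curvature
  contributes \<kappa> a b through \<open>pd 0 1 Q\<close> and -\<kappa> a a t through
  \<open>pd 0 1 P\<close>, which cancel because b = t a.\<close>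

lemma Omega_A:
  assumes z: "z \<in> U" "A z \<noteq> 0"
  shows "Omega A_nonzero z = 0"
proof -
  obtain t u v l where r: "b z = t * a z"
    "pdx \<eta> z = u * \<eta> z" "pdy \<eta> z = v * \<eta> z" "B z = t * A z"
    "pd 1 0 A z = A z * (u + p1 z + p2 z * t)"
    "pd 0 1 A z = A z * (v + q1 z + q2 z * t)"
    "pd 1 0 B z = A z * (u * t + q1 z + q2 z * t)"
    "pd 0 1 B z = A z * (v * t + r1 z + r2 z * t)"
    "pd 2 0 A z = A z * (l + 2 * u * (p1 z + p2 z * t)
       + (pdx p1 z + p1 z * (p1 z + p2 z * t) + pdx p2 z * t + p2 z * (q1 z + q2 z * t)))"
    "pd 2 0 B z = A z * (l * t + 2 * u * (q1 z + q2 z * t)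
       + (pdx q1 z + q1 z * (p1 z + p2 z * t) + pdx q2 z * t + q2 z * (q1 z + q2 z * t)))"
    by (rule ratios_A[OF z])
  show ?thesis
    unfolding Omega.simps r(4-) scaled_Omega_A[OF z(2)]
    unfolding P[OF z(1)] Q[OF z(1)] pd_coefficients[OF z(1)]
    unfolding curvature_solved[OF z(1)] r(1)
    by (simp add: field_simps eval_nat_numeral)
qed

lemma Omega_B:
  assumes z: "z \<in> U" "B z \<noteq> 0"
  shows "Omega B_nonzero z = 0"
proof -
  obtain t u v l where r: "a z = t * b z"
    "pdx \<eta> z = u * \<eta> z" "pdy \<eta> z = v * \<eta> z" "A z = t * B z"
    "pd 1 0 A z = B z * (u * t + p1 z * t + p2 z)"
    "pd 0 1 A z = B z * (v * t + q1 z * t + q2 z)"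
    "pd 1 0 B z = B z * (u + q1 z * t + q2 z)"
    "pd 0 1 B z = B z * (v + r1 z * t + r2 z)"
    "pd 0 2 A z = B z * (l * t + 2 * v * (q1 z * t + q2 z)
       + (pdy q1 z * t + q1 z * (q1 z * t + q2 z) + pdy q2 z + q2 z * (r1 z * t + r2 z)))"
    "pd 0 2 B z = B z * (l + 2 * v * (r1 z * t + r2 z)
       + (pdy r1 z * t + r1 z * (q1 z * t + q2 z) + pdy r2 z + r2 z * (r1 z * t + r2 z)))"
    by (rule ratios_B[OF z])
  show ?thesis
    unfolding Omega.simps r(4-) scaled_Omega_B[OF z(2)]
    unfolding S[OF z(1)] R[OF z(1)] pd_coefficients[OF z(1)]
    unfolding curvature_solved[OF z(1)] r(1)
    by (simp add: field_simps eval_nat_numeral)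
qed

end

section \<open>M, gamma and Gamma\<close>

lemma scaled_M_A:
  fixes A :: "'a::field_char_0"
  assumes "A \<noteq> 0"
  shows "- (12 * (t * A) * N * (t * A * P + A * x) / (5 * A)) + 24 / 5 * (t * A) * N * Q
     + 6 / 5 * N * (A * x') + 6 / 5 * N * (A * y) - A * Ny + t * A * Nx - 12 / 5 * A * N * R
   = A * (N * (- 12 / 5 * t * (t * P + x) + 24 / 5 * t * Q + 6 / 5 * x' + 6 / 5 * y - 12 / 5 * R)
     - Ny + t * Nx)"
  using assms by (simp add: field_simps)

lemma scaled_gamma_A:
  fixes A :: "'a::field_char_0"
  assumes "A \<noteq> 0"
  shows "- (6 * (t * A) * N * (t * A * P + A * x) / (5 * A ^ 2)) + 18 * N * (t * A) * Q / (5 * A)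
     + 6 * N * (A * x' + A * y) / (5 * A) - Ny - 12 / 5 * N * R - 2 * 0 * (t * A)
   = N * (- 6 / 5 * t * (t * P + x) + 18 / 5 * t * Q + 6 / 5 * (x' + y) - 12 / 5 * R) - Ny"
    "- (6 * N * (t * A * P + A * x) / (5 * A)) + Nx + 6 / 5 * N * Q + 2 * 0 * A
   = N * (- 6 / 5 * (t * P + x) + 6 / 5 * Q) + Nx"
  using assms by (simp_all add: field_simps power2_eq_square)

lemma scaled_M_B:
  fixes B :: "'a::field_char_0"
  assumes "B \<noteq> 0"
  shows "- (12 * (t * B) * N * (t * B * S - B * y') / (5 * B)) + 24 / 5 * (t * B) * N * R
     - 6 / 5 * N * (B * y) - 6 / 5 * N * (B * x') + B * Nx - t * B * Ny - 12 / 5 * B * N * Q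
   = B * (N * (- 12 / 5 * t * (t * S - y') + 24 / 5 * t * R - 6 / 5 * y - 6 / 5 * x' - 12 / 5 * Q)
     + Nx - t * Ny)"
  using assms by (simp add: field_simps)

lemma scaled_gamma_B:
  fixes B :: "'a::field_char_0"
  assumes "B \<noteq> 0"
  shows "- (6 * (t * B) * N * (t * B * S - B * y') / (5 * B ^ 2)) + 18 * N * (t * B) * R / (5 * B)
     - 6 * N * (B * y + B * x') / (5 * B) + Nx - 12 / 5 * N * Q + 2 * 0 * (t * B)
   = N * (- 6 / 5 * t * (t * S - y') + 18 / 5 * t * R - 6 / 5 * (y + x') - 12 / 5 * Q) + Nx"
    "- (6 * N * (t * B * S - B * y') / (5 * B)) - Ny + 6 / 5 * N * R - 2 * 0 * B
   = N * (- 6 / 5 * (t * S - y') + 6 / 5 * R) - Ny"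
  using assms by (simp_all add: field_simps power2_eq_square)

text \<open>The excluded values of Y are zeros of the target pseudoinvariants: \<alpha> has the
  factor 2 Y + 1, \<nu> the factor 5 - 2 Y and \<mu> the factor 2 Y - 35. Together with \<beta>
  nonzero this keeps all of them away from zero.\<close>

locale p34_regular_pullback = p34_pullback P Q R S U X Y s \<beta>
  for P Q R S :: "'a::real_normed_field \<times> 'a \<Rightarrow> 'a" and U :: "('a \<times> 'a) set"
    and X Y s :: "'a \<times> 'a \<Rightarrow> 'a" and \<beta> :: 'a +
  assumes \<beta>: "\<beta> \<noteq> 0"
    and regular: "z \<in> U \<Longrightarrow> 2 * s z ^ 3 + 1 \<noteq> 0" "z \<in> U \<Longrightarrow> 2 * s z ^ 3 - 5 \<noteq> 0"
      "z \<in> U \<Longrightarrow> 2 * s z ^ 3 - 35 \<noteq> 0"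
begin

text \<open>In either set of formulas M is A gamma1 + B gamma2; for the target B = 0 and gamma1 =
  g.\<close>

lemma \<mu>_eq_g:
  assumes "z \<in> U"
  shows "\<mu> z = \<alpha> z * g z"
proof -
  define k where "k = 2 * s z ^ 3 + 1"
  have "k \<noteq> 0" using regular(1)[OF assms] by (simp add: k_def)
  then show ?thesis
    using s_nonzero[OF assms] unfolding \<mu>_def \<alpha>_def g_def k_def[symmetric]
    by (simp add: field_simps eval_nat_numeral)
qed

lemma nonzero:
  assumes "z \<in> U"
  shows "\<alpha> z \<noteq> 0" "\<nu> z \<noteq> 0" "\<mu> z \<noteq> 0" "g z \<noteq> 0" "\<eta> z \<noteq> 0"
proof -
  show "\<alpha> z \<noteq> 0" "\<nu> z \<noteq> 0" and \<mu>: "\<mu> z \<noteq> 0" and "\<eta> z \<noteq> 0"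
    using regular[OF assms] s_nonzero[OF assms] J_nonzero[OF assms] \<beta>
    by (auto simp: \<alpha>_def \<nu>_def \<mu>_def \<eta>_def)
  show "g z \<noteq> 0" using \<mu> \<mu>_eq_g[OF assms] by auto
qed

lemma g_eq:
  assumes "z \<in> U" "\<alpha>Y z = w * \<alpha> z"
  shows "g z = 6 / 5 * \<nu> z * w - \<nu>Y z - 4 / 5 * \<rho> z * \<nu> z"
proof -
  have "\<alpha> z * g z = \<alpha> z * (6 / 5 * \<nu> z * w - \<nu>Y z - 4 / 5 * \<rho> z * \<nu> z)"
    unfolding \<mu>_eq_g[OF assms(1), symmetric] \<mu>_eq[OF assms(1)] assms(2) by (simp add: algebra_simps)
  then show ?thesis using nonzero(1)[OF assms(1)] mult_cancel_left by blast
qed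

lemma logarithmic_derivative_\<eta>:
  assumes z: "z \<in> U" and "pdx \<eta> z = u * \<eta> z" "pdy \<eta> z = v * \<eta> z"
  obtains w where "\<alpha>Y z = w * \<alpha> z" "u = w * c z + p1 z + q2 z + \<rho> z * c z"
    "v = w * d z + q1 z + r2 z + \<rho> z * d z"
proof
  have "J z * (\<alpha>Y z * c z + \<alpha> z * (p1 z + q2 z + \<rho> z * c z)) = J z * (u * \<alpha> z)"
    "J z * (\<alpha>Y z * d z + \<alpha> z * (q1 z + r2 z + \<rho> z * d z)) = J z * (v * \<alpha> z)"
    using assms(2,3) unfolding pdx_\<eta>[OF z] pdy_\<eta>[OF z] \<eta>_def by (simp_all only: mult_ac)
  then have eq: "u * \<alpha> z = \<alpha>Y z * c z + \<alpha> z * (p1 z + q2 z + \<rho> z * c z)"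
    "v * \<alpha> z = \<alpha>Y z * d z + \<alpha> z * (q1 z + r2 z + \<rho> z * d z)"
    using J_nonzero[OF z] mult_cancel_left by metis+
  show "\<alpha>Y z = \<alpha>Y z / \<alpha> z * \<alpha> z" using nonzero[OF z] by simp
  show "u = \<alpha>Y z / \<alpha> z * c z + p1 z + q2 z + \<rho> z * c z"
    "v = \<alpha>Y z / \<alpha> z * d z + q1 z + r2 z + \<rho> z * d z"
    using eq nonzero(1)[OF z] by (simp_all add: field_simps)
qed

lemma open_applies: "open {z \<in> U. applies t z}"
proof -
  have "open (U \<inter> f -` (- {0}))" if "continuous_on U f" for f :: "'a \<times> 'a \<Rightarrow> 'a"
    using continuous_open_preimage[OF that open_U] by blast
  from this[OF partials_continuous_on[OF partials_A]] this[OF partials_continuous_on[OF partials_B]]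
  show ?thesis
    by (cases t) (auto simp: Int_def vimage_def)
qed

lemma partials_N: "partials {z \<in> U. applies t z} (N t)
   (\<lambda>z. J z ^ 2 * (\<nu>Y z * c z + 2 * \<nu> z * (p1 z + q2 z + \<rho> z * c z)))
   (\<lambda>z. J z ^ 2 * (\<nu>Y z * d z + 2 * \<nu> z * (q1 z + r2 z + \<rho> z * d z)))"
  by (rule partials_cong[OF partials_subset[OF partials_mult[OF
        partials_power[OF partials_J, of 2] partials_\<nu>]] open_applies])
    (auto simp: N_eq algebra_simps power2_eq_square)

lemma Omega_eq: "z \<in> U \<Longrightarrow> applies t z \<Longrightarrow> Omega t z = 0"
  by (cases t) (simp_all del: Omega.simps add: Omega_A Omega_B)

text \<open>The field (d, -c) annihilates Y and sends X to J, so gamma is a multiple of the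
  derivative in X. In M, the factor a (d - t c) is once more J.\<close>

lemma M_gamma_A:
  assumes z: "z \<in> U" "A z \<noteq> 0"
  shows "M A_nonzero z = J z ^ 4 * \<mu> z"
    "gamma1 A_nonzero z = J z ^ 2 * g z * d z" "gamma2 A_nonzero z = - (J z ^ 2 * g z * c z)"
proof -
  obtain t u v l where r: "b z = t * a z"
    "pdx \<eta> z = u * \<eta> z" "pdy \<eta> z = v * \<eta> z" "B z = t * A z"
    "pd 1 0 A z = A z * (u + p1 z + p2 z * t)"
    "pd 0 1 A z = A z * (v + q1 z + q2 z * t)"
    "pd 1 0 B z = A z * (u * t + q1 z + q2 z * t)"
    by (rule ratios_A[OF z])
  obtain w where w: "\<alpha>Y z = w * \<alpha> z" "u = w * c z + p1 z + q2 z + \<rho> z * c z"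
    "v = w * d z + q1 z + r2 z + \<rho> z * d z"
    by (rule logarithmic_derivative_\<eta>[OF z(1) r(2,3)])
  have Nx: "pd 1 0 (N A_nonzero) z = J z ^ 2 * (\<nu>Y z * c z + 2 * \<nu> z * (p1 z + q2 z + \<rho> z * c z))"
    and Ny: "pd 0 1 (N A_nonzero) z = J z ^ 2 * (\<nu>Y z * d z + 2 * \<nu> z * (q1 z + r2 z + \<rho> z * d z))"
    using partials_pdx[OF partials_N[of A_nonzero], of z] partials_pdy[OF partials_N[of A_nonzero], of z] z
    by (simp_all add: pd_def)
  have N: "N A_nonzero z = J z ^ 2 * \<nu> z" using N_eq[of z A_nonzero] z by simp
  note sub = P[OF z(1)] Q[OF z(1)] R[OF z(1)]
  have J: "J z = a z * (d z - t * c z)" by (simp add: J_def r(1) algebra_simps)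
  have "M A_nonzero z = A z * J z ^ 2 * ((d z - t * c z) * g z)"
    unfolding M.simps r(4-) scaled_M_A[OF z(2)]
    unfolding N Nx Ny sub g_eq[OF z(1) w(1)] w(2,3)
    by (simp add: field_simps)
  also have "\<dots> = J z ^ 4 * \<mu> z"
    unfolding A_eq[OF z(1)] \<eta>_def \<mu>_eq_g[OF z(1)] by (simp add: J eval_nat_numeral mult_ac)
  finally show "M A_nonzero z = J z ^ 4 * \<mu> z" .
  show "gamma1 A_nonzero z = J z ^ 2 * g z * d z"
    unfolding gamma1.simps r(4-) Omega_A[OF z] scaled_gamma_A[OF z(2)]
    unfolding N Nx Ny sub g_eq[OF z(1) w(1)] w(2,3)
    by (simp add: field_simps)
  show "gamma2 A_nonzero z = - (J z ^ 2 * g z * c z)"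
    unfolding gamma2.simps r(4-) Omega_A[OF z] scaled_gamma_A[OF z(2)]
    unfolding N Nx Ny sub g_eq[OF z(1) w(1)] w(2,3)
    by (simp add: field_simps)
qed

lemma M_gamma_B:
  assumes z: "z \<in> U" "B z \<noteq> 0"
  shows "M B_nonzero z = J z ^ 4 * \<mu> z"
    "gamma1 B_nonzero z = J z ^ 2 * g z * d z" "gamma2 B_nonzero z = - (J z ^ 2 * g z * c z)"
proof -
  obtain t u v l where r: "a z = t * b z"
    "pdx \<eta> z = u * \<eta> z" "pdy \<eta> z = v * \<eta> z" "A z = t * B z"
    "pd 0 1 A z = B z * (v * t + q1 z * t + q2 z)"
    "pd 1 0 B z = B z * (u + q1 z * t + q2 z)"
    "pd 0 1 B z = B z * (v + r1 z * t + r2 z)"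
    by (rule ratios_B[OF z])
  obtain w where w: "\<alpha>Y z = w * \<alpha> z" "u = w * c z + p1 z + q2 z + \<rho> z * c z"
    "v = w * d z + q1 z + r2 z + \<rho> z * d z"
    by (rule logarithmic_derivative_\<eta>[OF z(1) r(2,3)])
  have Nx: "pd 1 0 (N B_nonzero) z = J z ^ 2 * (\<nu>Y z * c z + 2 * \<nu> z * (p1 z + q2 z + \<rho> z * c z))"
    and Ny: "pd 0 1 (N B_nonzero) z = J z ^ 2 * (\<nu>Y z * d z + 2 * \<nu> z * (q1 z + r2 z + \<rho> z * d z))"
    using partials_pdx[OF partials_N[of B_nonzero], of z] partials_pdy[OF partials_N[of B_nonzero], of z] z
    by (simp_all add: pd_def)
  have N: "N B_nonzero z = J z ^ 2 * \<nu> z" using N_eq[of z B_nonzero] z by simp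
  note sub = S[OF z(1)] Q[OF z(1)] R[OF z(1)]
  have J: "J z = b z * (t * d z - c z)" by (simp add: J_def r(1) algebra_simps)
  have "M B_nonzero z = B z * J z ^ 2 * ((t * d z - c z) * g z)"
    unfolding M.simps r(4-) scaled_M_B[OF z(2)]
    unfolding N Nx Ny sub g_eq[OF z(1) w(1)] w(2,3)
    by (simp add: field_simps)
  also have "\<dots> = J z ^ 4 * \<mu> z"
    unfolding B_eq[OF z(1)] \<eta>_def \<mu>_eq_g[OF z(1)] by (simp add: J eval_nat_numeral mult_ac)
  finally show "M B_nonzero z = J z ^ 4 * \<mu> z" .
  show "gamma1 B_nonzero z = J z ^ 2 * g z * d z"
    unfolding gamma1.simps r(4-) Omega_B[OF z] scaled_gamma_B[OF z(2)]
    unfolding N Nx Ny sub g_eq[OF z(1) w(1)] w(2,3)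
    by (simp add: field_simps)
  show "gamma2 B_nonzero z = - (J z ^ 2 * g z * c z)"
    unfolding gamma2.simps r(4-) Omega_B[OF z] scaled_gamma_B[OF z(2)]
    unfolding N Nx Ny sub g_eq[OF z(1) w(1)] w(2,3)
    by (simp add: field_simps)
qed

lemma
  assumes "z \<in> U" "applies t z"
  shows M_eq: "M t z = J z ^ 4 * \<mu> z" and gamma1_eq: "gamma1 t z = J z ^ 2 * g z * d z"
    and gamma2_eq: "gamma2 t z = - (J z ^ 2 * g z * c z)"
  using assms by (cases t; simp del: M.simps gamma1.simps gamma2.simps add: M_gamma_A M_gamma_B)+

text \<open>M Gamma is, up to sign, the determinant of gamma and its covariant derivative along
  itself. In the target variables gamma is J^3 g times the X-direction, whose covariant acceleration
  is -\<pi> in the Y-direction.\<close>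

lemma Gamma_eq:
  assumes z: "z \<in> U" "applies t z"
  shows "Gamma t z = J z ^ 4 * g z ^ 3 * \<pi> z / \<mu> z"
proof -
  \<comment> \<open>The derivatives of \<phi> cancel in Gamma, because (gamma1, gamma2) is \<phi> times the field (d, -c).\<close>
  define \<phi> where "\<phi> z = J z ^ 2 * g z" for z
  have "90 * (2 * s z ^ 3 + 1) * s z ^ 8 \<noteq> 0" if "z \<in> U" for z
    using regular(1)[OF that] s_nonzero[OF that] by (simp only: mult_eq_0_iff power_eq_0_iff) simp
  then have "smooth_on U \<phi>"
    unfolding \<phi>_def g_def by (intro smooth_intros smooth_J)
  note \<phi> = partials_subset[OF smooth_on_partials[OF this], of "{z \<in> U. applies t z}"]
  note cc = partials_subset[OF partials_c, of "{z \<in> U. applies t z}"]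
    and dd = partials_subset[OF partials_d, of "{z \<in> U. applies t z}"]
  note g1 = partials_cong[OF partials_mult[OF \<phi> dd] open_applies, OF _ _ _ refl refl, of "gamma1 t"]
  note g2 = partials_cong[OF partials_minus[OF partials_mult[OF \<phi> cc]] open_applies, OF _ _ _ refl refl, of "gamma2 t"]
  have 1: "pd 1 0 (gamma1 t) z = pdx \<phi> z * d z + \<phi> z * (q1 z * c z + q2 z * d z + \<pi> z * a z * b z + \<rho> z * c z * d z)"
    "pd 0 1 (gamma1 t) z = pdy \<phi> z * d z + \<phi> z * (r1 z * c z + r2 z * d z + \<pi> z * b z ^ 2 + \<rho> z * d z ^ 2)"
    using partials_pdx[OF g1] partials_pdy[OF g1] z
    by (auto simp: pd_def gamma1_eq \<phi>_def)
  have 2: "pd 1 0 (gamma2 t) z = - (pdx \<phi> z * c z + \<phi> z * (p1 z * c z + p2 z * d z + \<pi> z * a z ^ 2 + \<rho> z * c z ^ 2))"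
    "pd 0 1 (gamma2 t) z = - (pdy \<phi> z * c z + \<phi> z * (q1 z * c z + q2 z * d z + \<pi> z * a z * b z + \<rho> z * c z * d z))"
    using partials_pdx[OF g2] partials_pdy[OF g2] z
    by (auto simp: pd_def gamma2_eq \<phi>_def)
  have 3: "gamma1 t z = \<phi> z * d z" "gamma2 t z = - (\<phi> z * c z)"
    using z by (simp_all add: gamma1_eq gamma2_eq \<phi>_def)
  have "Gamma t z = (\<phi> z ^ 3 * \<pi> z * (a z * d z - b z * c z) ^ 2) / M t z"
    unfolding Gamma_def 1 2 3 P[OF z(1)] Q[OF z(1)] R[OF z(1)] S[OF z(1)] add_divide_distrib[symmetric]
    by (rule arg_cong[of _ _ "\<lambda>x. x / M t z"]) (simp add: field_simps eval_nat_numeral)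
  also have "\<dots> = J z ^ 4 * g z ^ 3 * \<pi> z / \<mu> z"
    using J_nonzero[OF z(1)] nonzero[OF z(1)] unfolding J_def[symmetric] M_eq[OF z] \<phi>_def
    by (simp add: field_simps eval_nat_numeral)
  finally show ?thesis .
qed

end

subsection \<open>The invariants as functions of the target variables\<close>

text \<open>Here y, i, i' stand for Y, I1, I4. The first identity puts the rational curve y -> (i,
  i') on the zero set of K; the other two show that the quotient defining \<open>ytilde\<close>
  recovers y, with a denominator that vanishes only for 2 y + 1 = 0.\<close>

lemma K_identity:
  fixes y :: "'a::field_char_0"
  assumes "2 * y - 5 \<noteq> 0" "i = 36 * y * (2 * y - 35) / (5 * (2 * y - 5) ^ 2)"
    "i' = - (3240 * y * (2 * y + 1) * (2 * y + 7) / (2 * y - 5) ^ 4)"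
  shows "500 * i ^ 4 - 7275 * i ^ 3 + 500 * i' * i ^ 2 + 32940 * i ^ 2 - 5475 * i' * i - 47628 * i
      + 125 * i' ^ 2 + 13230 * i' = 0"
    and "125 * (10 * i - 111) * i' + 3 * (5 * i - 18) * (225 * i ^ 2 - 5245 * i + 27216)
      = - (22963500000 * (2 * y + 1) / (2 * y - 5) ^ 6)"
    and "125 / 2 * ((3 + 20 * i) * i' + 3 * i * (5 * i - 18) * (5 * i - 43))
      = y * (125 * (10 * i - 111) * i' + 3 * (5 * i - 18) * (225 * i ^ 2 - 5245 * i + 27216))"
proof -
  \<comment> \<open>In terms of j both invariants are polynomials.\<close>
  define j where "j = 1 / (2 * y - 5)"
  have j0: "j \<noteq> 0" using assms(1) by (simp add: j_def)
  have y: "y = 1 / (2 * j) + 5 / 2" using assms(1) by (simp add: j_def field_simps)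
  have e: "2 * y - 5 = 1 / j" "2 * y - 35 = (1 - 30 * j) / j" "y = (1 + 5 * j) / (2 * j)"
    "2 * y + 1 = (1 + 6 * j) / j" "2 * y + 7 = (1 + 12 * j) / j"
    using j0 unfolding y by (simp_all add: field_simps)
  have i: "i = 18 / 5 * (1 + 5 * j) * (1 - 30 * j)"
    using j0 unfolding assms(2) e(1,2) by (subst e(3)) (simp add: field_simps power2_eq_square)
  have i': "i' = - (1620 * j * (1 + 5 * j) * (1 + 6 * j) * (1 + 12 * j))"
    using j0 unfolding assms(3) e(1,4,5) by (subst e(3)) (simp add: field_simps eval_nat_numeral)
  show "500 * i ^ 4 - 7275 * i ^ 3 + 500 * i' * i ^ 2 + 32940 * i ^ 2 - 5475 * i' * i - 47628 * i
      + 125 * i' ^ 2 + 13230 * i' = 0"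
    unfolding i i' by (simp add: field_simps eval_nat_numeral)
  have den: "125 * (10 * i - 111) * i' + 3 * (5 * i - 18) * (225 * i ^ 2 - 5245 * i + 27216)
      = - (22963500000 * (1 + 6 * j) * j ^ 5)"
    unfolding i i' by (simp add: field_simps eval_nat_numeral)
  show "125 * (10 * i - 111) * i' + 3 * (5 * i - 18) * (225 * i ^ 2 - 5245 * i + 27216)
      = - (22963500000 * (2 * y + 1) / (2 * y - 5) ^ 6)"
    unfolding den e using j0 by (simp add: field_simps eval_nat_numeral)
  have num: "125 / 2 * ((3 + 20 * i) * i' + 3 * i * (5 * i - 18) * (5 * i - 43))
      = - (22963500000 / 2 * (1 + 5 * j) * (1 + 6 * j) * j ^ 4)"
    unfolding i i' by (simp add: field_simps eval_nat_numeral)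
  show "125 / 2 * ((3 + 20 * i) * i' + 3 * i * (5 * i - 18) * (5 * i - 43))
      = y * (125 * (10 * i - 111) * i' + 3 * (5 * i - 18) * (225 * i ^ 2 - 5245 * i + 27216))"
    unfolding num den using j0 by (subst e(3)) (simp add: field_simps eval_nat_numeral)
qed

context p34_regular_pullback
begin

text \<open>Dependence on Y alone is encoded infinitesimally, by a gradient proportional to that of
  Y; no function of one variable has to be produced, and this is just what differentiation along
  gamma annihilates.\<close>

definition function_of_Y where
  "function_of_Y f \<longleftrightarrow> (\<exists>f'. partials U f (\<lambda>z. f' z * c z) (\<lambda>z. f' z * d z))"

lemma function_of_Y_const: "function_of_Y (\<lambda>_. k)"
  unfolding function_of_Y_def using partials_const[of U k] by (intro exI[of _ "\<lambda>_. 0"]) simp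

lemma function_of_Y_add: "function_of_Y e \<Longrightarrow> function_of_Y f \<Longrightarrow> function_of_Y (\<lambda>z. e z + f z)"
  unfolding function_of_Y_def
  apply clarify subgoal for e' f'
    by (intro exI[of _ "\<lambda>z. e' z + f' z"] partials_eqI[OF partials_add[of U e _ _ f]]) (auto simp: algebra_simps)
  done

lemma function_of_Y_mult: "function_of_Y e \<Longrightarrow> function_of_Y f \<Longrightarrow> function_of_Y (\<lambda>z. e z * f z)"
  unfolding function_of_Y_def
  apply clarify subgoal for e' f'
    by (intro exI[of _ "\<lambda>z. e' z * f z + e z * f' z"] partials_eqI[OF partials_mult[of U e _ _ f]]) (auto simp: algebra_simps)
  done

lemma function_of_Y_diff: "function_of_Y e \<Longrightarrow> function_of_Y f \<Longrightarrow> function_of_Y (\<lambda>z. e z - f z)"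
  using function_of_Y_add[of e "\<lambda>z. - 1 * f z"] function_of_Y_mult[OF function_of_Y_const[of "- 1"], of f]
  by simp

lemma function_of_Y_power: "function_of_Y f \<Longrightarrow> function_of_Y (\<lambda>z. f z ^ n)"
  by (induction n) (auto intro: function_of_Y_const function_of_Y_mult)

lemma function_of_Y_divide:
  assumes "function_of_Y e" "function_of_Y f" "\<And>z. z \<in> U \<Longrightarrow> f z \<noteq> 0"
  shows "function_of_Y (\<lambda>z. e z / f z)"
proof -
  obtain f' where f': "partials U f (\<lambda>z. f' z * c z) (\<lambda>z. f' z * d z)"
    using assms(2) by (auto simp: function_of_Y_def)
  have "partials U (\<lambda>z. inverse (f z)) (\<lambda>z. - (f' z / f z ^ 2) * c z) (\<lambda>z. - (f' z / f z ^ 2) * d z)"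
    by (rule partials_eqI[OF partials_inverse[OF f' assms(3)]]) auto
  then have "function_of_Y (\<lambda>z. inverse (f z))"
    unfolding function_of_Y_def by (intro exI[of _ "\<lambda>z. - (f' z / f z ^ 2)"])
  from function_of_Y_mult[OF assms(1) this] show ?thesis by (simp add: divide_inverse)
qed

lemma function_of_Y_s: "function_of_Y s"
  unfolding function_of_Y_def using partials_s
  by (intro exI[of _ "\<lambda>z. 1 / (3 * s z ^ 2)"]) simp

lemmas function_of_Y_intros = function_of_Y_const function_of_Y_add function_of_Y_diff
  function_of_Y_mult function_of_Y_power function_of_Y_divide function_of_Y_s

text \<open>(B, -A) is \<eta> (b, -a), which annihilates X, while (b, -a) sends Y to -J; gamma is
  J^2 g (d, -c), which annihilates Y, while (d, -c) sends X to J. The powers of J cancel against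
  those of N.\<close>

lemma derivative_along_pseudovectors:
  assumes f: "partials {z \<in> U. applies t z} f
      (\<lambda>z. fX z * a z + fY z * c z) (\<lambda>z. fX z * b z + fY z * d z)"
    and z: "z \<in> U" "applies t z"
  shows "(B z * pd 1 0 f z - A z * pd 0 1 f z) / N t z
      = 18 * s z ^ 3 * (2 * s z ^ 3 + 1) / (5 - 2 * s z ^ 3) * fY z"
    and "(gamma1 t z * pd 1 0 f z + gamma2 t z * pd 0 1 f z) ^ 2 / N t z ^ 3
      = (g z * fX z) ^ 2 / \<nu> z ^ 3"
proof -
  have d: "pd 1 0 f z = fX z * a z + fY z * c z" "pd 0 1 f z = fX z * b z + fY z * d z"
    using partials_pdx[OF f] partials_pdy[OF f] z by (simp_all add: pd_def)
  have "B z * pd 1 0 f z - A z * pd 0 1 f z = - (J z ^ 2 * \<alpha> z * fY z)"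
    unfolding d A_eq[OF z(1)] B_eq[OF z(1)] \<eta>_def J_def by (simp add: algebra_simps power2_eq_square)
  then have "(B z * pd 1 0 f z - A z * pd 0 1 f z) / N t z = - (\<alpha> z / \<nu> z) * fY z"
    using J_nonzero[OF z(1)] nonzero[OF z(1)] by (simp add: N_eq[OF z])
  also have "- (\<alpha> z / \<nu> z) = 18 * s z ^ 3 * (2 * s z ^ 3 + 1) / (5 - 2 * s z ^ 3)"
  proof -
    define k where "k = 5 - 2 * s z ^ 3"
    have "k \<noteq> 0" using regular(2)[OF z(1)] by (auto simp: k_def)
    then show ?thesis using s_nonzero[OF z(1)] \<beta>
      unfolding \<alpha>_def \<nu>_def k_def[symmetric] by (simp add: field_simps eval_nat_numeral)
  qed
  finally show "(B z * pd 1 0 f z - A z * pd 0 1 f z) / N t z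
      = 18 * s z ^ 3 * (2 * s z ^ 3 + 1) / (5 - 2 * s z ^ 3) * fY z" .
  have "gamma1 t z * pd 1 0 f z + gamma2 t z * pd 0 1 f z = J z ^ 3 * (g z * fX z)"
    unfolding d gamma1_eq[OF z] gamma2_eq[OF z] by (simp add: J_def algebra_simps eval_nat_numeral)
  then show "(gamma1 t z * pd 1 0 f z + gamma2 t z * pd 0 1 f z) ^ 2 / N t z ^ 3
      = (g z * fX z) ^ 2 / \<nu> z ^ 3"
    using J_nonzero[OF z(1)] nonzero[OF z(1)]
    by (simp add: N_eq[OF z] power_mult_distrib flip: power_mult)
qed

lemma derivative_along_function_of_Y:
  assumes f: "function_of_Y f'" "\<And>z. z \<in> U \<Longrightarrow> applies t z \<Longrightarrow> f z = f' z"
    and z: "z \<in> U" "applies t z"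
  shows "(gamma1 t z * pd 1 0 f z + gamma2 t z * pd 0 1 f z) ^ 2 / N t z ^ 3 = 0"
proof -
  obtain h where "partials U f' (\<lambda>z. h z * c z) (\<lambda>z. h z * d z)"
    using f(1) by (auto simp: function_of_Y_def)
  then have "partials {z \<in> U. applies t z} f
      (\<lambda>z. 0 * a z + h z * c z) (\<lambda>z. 0 * b z + h z * d z)"
    by (intro partials_cong[OF partials_subset open_applies]) (auto simp: f(2))
  from derivative_along_pseudovectors(2)[OF this z] show ?thesis by simp
qed

definition \<iota>1 where "\<iota>1 z = 36 * s z ^ 3 * (2 * s z ^ 3 - 35) / (5 * (2 * s z ^ 3 - 5) ^ 2)"
text \<open>I3 is a polynomial in \<tau> and \<omega>, with s^3 = (1 - \<tau>) / (2 \<tau>).\<close>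

definition \<tau> where "\<tau> z = 1 / (2 * s z ^ 3 + 1)"
definition \<omega> where "\<omega> z = X z * s z ^ 2"
definition \<iota>3 where "\<iota>3 z = (1 - \<tau> z) * (1 - 36 * \<tau> z) * (2 - \<tau> z + 2 * \<omega> z * \<tau> z) / 30"

lemma I1_eq: "z \<in> U \<Longrightarrow> applies t z \<Longrightarrow> I1 t z = \<iota>1 z"
proof -
  assume z: "z \<in> U" "applies t z"
  define k where "k = 2 * s z ^ 3 - 5"
  have k: "k \<noteq> 0" "5 - 2 * s z ^ 3 = - k" using regular(2)[OF z(1)] by (auto simp: k_def)
  have "I1 t z = \<mu> z / \<nu> z ^ 2"
    using J_nonzero[OF z(1)] by (simp add: I1_def M_eq[OF z] N_eq[OF z] power_mult_distrib flip: power_mult)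
  also have "\<dots> = \<iota>1 z"
    using k(1) s_nonzero[OF z(1)] \<beta> unfolding \<mu>_def \<nu>_def \<iota>1_def k(2) k_def[symmetric]
    by (simp add: field_simps eval_nat_numeral)
  finally show ?thesis .
qed

lemma reciprocals:
  assumes "z \<in> U"
  shows "2 * s z ^ 3 + 1 = 1 / \<tau> z" "\<tau> z \<noteq> 0" "s z ^ 3 = (1 - \<tau> z) / (2 * \<tau> z)"
    "2 * s z ^ 3 - 35 = (1 - 36 * \<tau> z) / \<tau> z" "2 * s z ^ 3 - 5 = (1 - 6 * \<tau> z) / \<tau> z"
    "5 - 2 * s z ^ 3 = - (1 - 6 * \<tau> z) / \<tau> z" "2 * s z ^ 3 - 1 = (1 - 2 * \<tau> z) / \<tau> z"
    "1 - \<tau> z \<noteq> 0" "1 - 6 * \<tau> z \<noteq> 0" "1 - 36 * \<tau> z \<noteq> 0"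
proof -
  show \<tau>: "\<tau> z \<noteq> 0" "2 * s z ^ 3 + 1 = 1 / \<tau> z"
    using regular(1)[OF assms] by (simp_all add: \<tau>_def)
  show y: "s z ^ 3 = (1 - \<tau> z) / (2 * \<tau> z)"
  proof -
    have "s z ^ 3 = (1 / \<tau> z - 1) / 2" unfolding \<tau>(2)[symmetric] by simp
    also have "\<dots> = (1 - \<tau> z) / (2 * \<tau> z)" using \<tau>(1) by (simp add: field_simps)
    finally show ?thesis .
  qed
  show y': "2 * s z ^ 3 - 35 = (1 - 36 * \<tau> z) / \<tau> z" "2 * s z ^ 3 - 5 = (1 - 6 * \<tau> z) / \<tau> z"
    "5 - 2 * s z ^ 3 = - (1 - 6 * \<tau> z) / \<tau> z" "2 * s z ^ 3 - 1 = (1 - 2 * \<tau> z) / \<tau> z"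
    unfolding y using \<tau>(1) by (simp_all add: field_simps)
  show "1 - \<tau> z \<noteq> 0" using y s_nonzero[OF assms] by auto
  show "1 - 6 * \<tau> z \<noteq> 0" using y'(2) regular(2)[OF assms] by auto
  show "1 - 36 * \<tau> z \<noteq> 0" using y'(1) regular(3)[OF assms] by auto
qed

lemma I3_eq:
  assumes z: "z \<in> U" "applies t z"
  shows "I3 t z = \<iota>3 z"
proof -
  define k where "k = 2 * s z ^ 3 + 1"
  have k: "k \<noteq> 0" using regular(1)[OF z(1)] by (auto simp: k_def)
  have "I3 t z = g z * \<pi> z / \<alpha> z ^ 2"
    using J_nonzero[OF z(1)] nonzero[OF z(1)]
    by (simp add: I3_def Gamma_eq[OF z] M_eq[OF z] \<mu>_eq_g[OF z(1)] field_simps eval_nat_numeral)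
  also have "\<dots> = s z ^ 3 * (2 * s z ^ 3 - 35) * (4 * s z ^ 3 + 2 * \<omega> z + 1) / (15 * (2 * s z ^ 3 + 1) ^ 3)"
    using k s_nonzero[OF z(1)] \<beta> unfolding \<alpha>_def g_def \<omega>_def \<pi>_def k_def[symmetric]
    by (simp add: field_simps eval_nat_numeral)
  also have "\<dots> = \<iota>3 z"
    using reciprocals(2)[OF z(1)] unfolding \<iota>3_def reciprocals[OF z(1)]
    by (simp add: field_simps eval_nat_numeral)
  finally show ?thesis .
qed

definition \<iota>1Y where "\<iota>1Y z = 180 * (2 * s z ^ 3 + 7) / (2 * s z ^ 3 - 5) ^ 3"
definition \<iota>3X where "\<iota>3X z = (1 - \<tau> z) * (1 - 36 * \<tau> z) * s z ^ 2 * \<tau> z / 15"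
text \<open>The Y-derivative of \<open>\<iota>3\<close> is affine in X, and the final digit is the
  power of X. In \<open>\<iota>3Y1\<close> the term with 1/s comes from differentiating s^2 in
  \<omega>.\<close>

definition \<iota>3Y0 where "\<iota>3Y0 z = ((37 - 72 * \<tau> z) * (2 - \<tau> z) + (1 - \<tau> z) * (1 - 36 * \<tau> z)) * \<tau> z ^ 2 / 15"
definition \<iota>3Y1 where "\<iota>3Y1 z = ((37 - 72 * \<tau> z) * \<tau> z * s z ^ 2 * 2
   + (1 - \<tau> z) * (1 - 36 * \<tau> z) * (2 / (3 * s z * \<tau> z) - 2 * s z ^ 2)) * \<tau> z ^ 2 / 15"

lemma partials_\<tau>: "partials U \<tau> (\<lambda>z. - (2 * \<tau> z ^ 2 * c z)) (\<lambda>z. - (2 * \<tau> z ^ 2 * d z))"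
proof -
  have Y: "partials U Y c d" by (rule smooth_on_partials[OF smooth_Y])
  have m: "2 * Y z + 1 \<noteq> 0" if "z \<in> U" for z using regular(1)[OF that] by (simp add: cube[OF that])
  show ?thesis
    by (rule partials_cong[OF partials_inverse[OF partials_add[OF partials_cmult[OF Y, of 2]
            partials_const, of 1] m] open_U])
      (auto simp: \<tau>_def cube field_simps)
qed

lemma partials_\<iota>1: "partials U \<iota>1 (\<lambda>z. \<iota>1Y z * c z) (\<lambda>z. \<iota>1Y z * d z)"
proof -
  \<comment> \<open>In terms of \<sigma> the function \<open>\<iota>1\<close> is a quadratic
    polynomial, and the Y-derivative of \<sigma> is -2 \<sigma>^2.\<close>
  define \<sigma> where "\<sigma> z = 1 / (2 * s z ^ 3 - 5)" for z
  have Y: "partials U Y c d" by (rule smooth_on_partials[OF smooth_Y])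
  have k: "2 * Y z - 5 \<noteq> 0" if "z \<in> U" for z using regular(2)[OF that] by (simp add: cube[OF that])
  have \<sigma>: "partials U \<sigma> (\<lambda>z. - (2 * \<sigma> z ^ 2 * c z)) (\<lambda>z. - (2 * \<sigma> z ^ 2 * d z))"
    by (rule partials_cong[OF partials_inverse[OF partials_diff[OF partials_cmult[OF Y, of 2]
            partials_const, of 5] k] open_U])
      (auto simp: \<sigma>_def cube field_simps)
  have r: "s z ^ 3 = (1 + 5 * \<sigma> z) / (2 * \<sigma> z)" "\<sigma> z \<noteq> 0" if "z \<in> U" for z
  proof -
    show \<sigma>: "\<sigma> z \<noteq> 0" using regular(2)[OF that] by (simp add: \<sigma>_def)
    have "s z ^ 3 = (1 / \<sigma> z + 5) / 2" using regular(2)[OF that] by (simp add: \<sigma>_def)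
    also have "\<dots> = (1 + 5 * \<sigma> z) / (2 * \<sigma> z)" using \<sigma> by (simp add: field_simps)
    finally show "s z ^ 3 = (1 + 5 * \<sigma> z) / (2 * \<sigma> z)" .
  qed
  have e: "2 * s z ^ 3 - 5 = 1 / \<sigma> z" "2 * s z ^ 3 - 35 = (1 - 30 * \<sigma> z) / \<sigma> z"
    "2 * s z ^ 3 + 7 = (1 + 12 * \<sigma> z) / \<sigma> z" if "z \<in> U" for z
    using r[OF that] by (simp_all add: field_simps)
  have 1: "\<iota>1 z = 18 / 5 - 90 * \<sigma> z - 540 * \<sigma> z ^ 2" if "z \<in> U" for z
    unfolding \<iota>1_def e[OF that] r(1)[OF that] using r(2)[OF that]
    by (simp add: field_simps eval_nat_numeral)
  have 2: "\<iota>1Y z = 180 * (\<sigma> z ^ 2 + 12 * \<sigma> z ^ 3)" if "z \<in> U" for z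
    unfolding \<iota>1Y_def e[OF that] using r(2)[OF that]
    by (simp add: field_simps eval_nat_numeral)
  show ?thesis
    by (rule partials_cong[OF partials_diff[OF partials_diff[OF partials_const[of U "18 / 5"]
            partials_cmult[OF \<sigma>, of 90]] partials_cmult[OF partials_power[OF \<sigma>, of 2], of 540]] open_U])
      (auto simp: 1 2 algebra_simps eval_nat_numeral)
qed

lemma partials_\<omega>: "partials U \<omega> (\<lambda>z. s z ^ 2 * a z + 2 * X z / (3 * s z) * c z)
   (\<lambda>z. s z ^ 2 * b z + 2 * X z / (3 * s z) * d z)"
  by (rule partials_cong[OF partials_mult[OF partials_X partials_power[OF partials_s, of 2]] open_U])
    (auto simp: \<omega>_def s_nonzero field_simps power2_eq_square)

lemma partials_\<iota>3: "partials U \<iota>3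
   (\<lambda>z. \<iota>3X z * a z + (\<iota>3Y0 z + X z * \<iota>3Y1 z) * c z)
   (\<lambda>z. \<iota>3X z * b z + (\<iota>3Y0 z + X z * \<iota>3Y1 z) * d z)"
  unfolding \<iota>3_def
  by (rule partials_eqI, (rule partials_intros partials_\<tau> partials_\<omega> open_U | (simp; fail))+)
    (auto simp: \<iota>3X_def \<iota>3Y0_def \<iota>3Y1_def \<omega>_def s_nonzero reciprocals(2) field_simps eval_nat_numeral)

definition \<delta> where "\<delta> z = 18 * s z ^ 3 * (2 * s z ^ 3 + 1) / (5 - 2 * s z ^ 3)"
definition \<iota>6 where "\<iota>6 z = \<delta> z * (\<iota>3Y0 z + X z * \<iota>3Y1 z)"
definition \<iota>9 where "\<iota>9 z = - (64 / 625) * (s z ^ 18 * (2 * s z ^ 3 - 35) ^ 4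
   / (\<beta> ^ 2 * (2 * s z ^ 3 + 1) ^ 8 * (2 * s z ^ 3 - 5) ^ 3))"

lemma I4_eq: "z \<in> U \<Longrightarrow> applies t z \<Longrightarrow> I4 t z = \<delta> z * \<iota>1Y z"
  and I7_eq: "z \<in> U \<Longrightarrow> applies t z \<Longrightarrow> I7 t z = 0"
proof -
  assume z: "z \<in> U" "applies t z"
  have "partials {z \<in> U. applies t z} (I1 t)
      (\<lambda>z. 0 * a z + \<iota>1Y z * c z) (\<lambda>z. 0 * b z + \<iota>1Y z * d z)"
    by (rule partials_cong[OF partials_subset[OF partials_\<iota>1] open_applies]) (auto simp: I1_eq)
  note * = derivative_along_pseudovectors[OF this z]
  show "I4 t z = \<delta> z * \<iota>1Y z" "I7 t z = 0"
    using * by (simp_all add: I4_def I7_def \<delta>_def)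
qed

lemma I6_eq: "z \<in> U \<Longrightarrow> applies t z \<Longrightarrow> I6 t z = \<iota>6 z"
  and I9_eq_g: "z \<in> U \<Longrightarrow> applies t z \<Longrightarrow> I9 t z = (g z * \<iota>3X z) ^ 2 / \<nu> z ^ 3"
proof -
  assume z: "z \<in> U" "applies t z"
  have "partials {z \<in> U. applies t z} (I3 t)
      (\<lambda>z. \<iota>3X z * a z + (\<iota>3Y0 z + X z * \<iota>3Y1 z) * c z)
      (\<lambda>z. \<iota>3X z * b z + (\<iota>3Y0 z + X z * \<iota>3Y1 z) * d z)"
    by (rule partials_cong[OF partials_subset[OF partials_\<iota>3] open_applies]) (auto simp: I3_eq)
  note * = derivative_along_pseudovectors[OF this z]
  show "I6 t z = \<iota>6 z" "I9 t z = (g z * \<iota>3X z) ^ 2 / \<nu> z ^ 3"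
    unfolding I6_def I9_def * \<iota>6_def \<delta>_def by simp_all
qed

lemma function_of_Y_\<tau>: "function_of_Y \<tau>"
  unfolding \<tau>_def by (intro function_of_Y_intros regular)

lemma function_of_Y_\<delta>: "function_of_Y \<delta>"
  unfolding \<delta>_def using regular(2) by (intro function_of_Y_intros) auto

lemma function_of_Y_\<iota>3Y0: "function_of_Y \<iota>3Y0"
  unfolding \<iota>3Y0_def by (intro function_of_Y_intros function_of_Y_\<tau>) simp

lemma function_of_Y_\<iota>3Y1: "function_of_Y \<iota>3Y1"
  unfolding \<iota>3Y1_def
  by (intro function_of_Y_intros function_of_Y_\<tau>) (simp_all add: s_nonzero reciprocals)

lemma function_of_Y_\<iota>9: "function_of_Y \<iota>9"
proof -
  have "\<beta> ^ 2 * (2 * s z ^ 3 + 1) ^ 8 * (2 * s z ^ 3 - 5) ^ 3 \<noteq> 0" if "z \<in> U" for z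
    using regular[OF that] \<beta> by simp
  then show ?thesis unfolding \<iota>9_def by (intro function_of_Y_intros)
qed

text \<open>I6 is again affine in X, with coefficients depending on Y alone, so its X-derivative is
  the coefficient \<open>\<delta> z * \<iota>3Y1 z\<close>.\<close>

lemma I15_eq_g:
  assumes z: "z \<in> U" "applies t z"
  shows "I15 t z = (g z * (\<delta> z * \<iota>3Y1 z)) ^ 2 / \<nu> z ^ 3"
proof -
  obtain e f where e: "partials U (\<lambda>z. \<delta> z * \<iota>3Y0 z) (\<lambda>z. e z * c z) (\<lambda>z. e z * d z)"
    and f: "partials U (\<lambda>z. \<delta> z * \<iota>3Y1 z) (\<lambda>z. f z * c z) (\<lambda>z. f z * d z)"
    using function_of_Y_mult[OF function_of_Y_\<delta> function_of_Y_\<iota>3Y0]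
      function_of_Y_mult[OF function_of_Y_\<delta> function_of_Y_\<iota>3Y1]
    by (auto simp: function_of_Y_def)
  have "partials {z \<in> U. applies t z} (I6 t)
      (\<lambda>z. (\<delta> z * \<iota>3Y1 z) * a z + (e z + X z * f z) * c z)
      (\<lambda>z. (\<delta> z * \<iota>3Y1 z) * b z + (e z + X z * f z) * d z)"
    by (rule partials_cong[OF partials_subset[OF partials_add[OF e partials_mult[OF partials_X f]]] open_applies])
      (auto simp: I6_eq \<iota>6_def algebra_simps)
  from derivative_along_pseudovectors(2)[OF this z] show ?thesis unfolding I15_def .
qed

text \<open>Both g and \<nu> are multiples of \<beta>^2 while \<open>\<iota>3X\<close> is free of
  \<beta>. Hence I9 scales as \<beta>^-2, and condition 5 solves it for \<beta>^2.\<close>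

lemma I9_eq:
  assumes z: "z \<in> U" "applies t z"
  shows "I9 t z = \<iota>9 z"
proof -
  define k l m where "k = 2 * s z ^ 3 - 5" and "l = 2 * s z ^ 3 - 35" and "m = 2 * s z ^ 3 + 1"
  have nz: "k \<noteq> 0" "m \<noteq> 0" "s z \<noteq> 0" and k: "5 - 2 * s z ^ 3 = - k"
    using regular[OF z(1)] s_nonzero[OF z(1)] by (auto simp: k_def m_def)
  have "\<iota>3X z = 2 * s z ^ 5 * l / (15 * m ^ 3)"
    using nz unfolding \<iota>3X_def \<tau>_def m_def[symmetric]
    by (simp add: field_simps) (simp add: m_def l_def algebra_simps eval_nat_numeral)
  note \<iota>3X = this
  show ?thesis
    using nz \<beta> unfolding I9_eq_g[OF z] \<iota>9_def \<iota>3X g_def \<nu>_def k k_def[symmetric] l_def[symmetric] m_def[symmetric]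
    by (simp add: field_simps eval_nat_numeral)
qed

lemma I21_eq: "z \<in> U \<Longrightarrow> applies t z \<Longrightarrow> I21 t z = 0"
  unfolding I21_def by (rule derivative_along_function_of_Y[OF function_of_Y_\<iota>9 I9_eq])

end

section \<open>The conditions at a single point\<close>

context p34_regular_pullback
begin

lemma condition3_ytilde:
  assumes z: "z \<in> U" "applies t z"
  shows "condition3 t z" "ytilde_denom t z \<noteq> 0" "ytilde t z = Y z"
proof -
  have I1: "I1 t z = 36 * Y z * (2 * Y z - 35) / (5 * (2 * Y z - 5) ^ 2)"
    by (simp add: I1_eq[OF z] \<iota>1_def cube[OF z(1)])
  define k where "k = 2 * Y z - 5"
  have k: "k \<noteq> 0" "5 - 2 * Y z = - k"
    using regular(2)[OF z(1)] by (simp_all add: k_def cube[OF z(1)])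
  have I4: "I4 t z = - (3240 * Y z * (2 * Y z + 1) * (2 * Y z + 7) / (2 * Y z - 5) ^ 4)"
    using k(1) unfolding I4_eq[OF z] \<delta>_def \<iota>1Y_def cube[OF z(1), symmetric] k(2) k_def[symmetric]
    by (simp add: field_simps eval_nat_numeral)
  have k0: "2 * Y z - 5 \<noteq> 0" using k(1) by (simp add: k_def)
  note K = K_identity[OF k0 I1 I4]
  show "condition3 t z" unfolding condition3_def K_def using K(1) .
  show *: "ytilde_denom t z \<noteq> 0"
    using regular[OF z(1)] unfolding ytilde_denom_def K(2) cube[OF z(1), symmetric]
    by (simp del: distrib_left_numeral)
  show "ytilde t z = Y z"
    unfolding ytilde_def times_divide_eq_right K(3) ytilde_denom_def[symmetric] using * by simp
qed

text \<open>The numerator is 15 I3 (2 Y + 1)^3 - Y (2 Y - 35) (4 Y + 1). As I3 is Y (2 Y - 35) (4 Y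
  + 2 \<omega> + 1) / (15 (2 Y + 1)^3), it equals 2 Y (2 Y - 35) \<omega>: the formula solves I3 for
  X.\<close>

lemma xtilde_eq_X:
  assumes z: "z \<in> U" "applies t z" and s: "cbrt (Y z) = s z"
  shows "xtilde cbrt t z = X z"
proof -
  note r = reciprocals[OF z(1)]
  have "xtilde cbrt t z = ((120 * \<iota>3 z - 8) * (s z ^ 3) ^ 3 + (138 + 180 * \<iota>3 z) * (s z ^ 3) ^ 2
       + (90 * \<iota>3 z + 35) * s z ^ 3 + 15 * \<iota>3 z) / (2 * s z ^ 3 * (s z ^ 2 * (2 * s z ^ 3 - 35)))"
    unfolding xtilde_def condition3_ytilde(3)[OF z] I3_eq[OF z] s unfolding cube[OF z(1)]
    by (simp add: eval_nat_numeral mult_ac)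
  also have "\<dots> = \<omega> z / s z ^ 2"
  proof -
    have "((120 * \<iota>3 z - 8) * (s z ^ 3) ^ 3 + (138 + 180 * \<iota>3 z) * (s z ^ 3) ^ 2
       + (90 * \<iota>3 z + 35) * s z ^ 3 + 15 * \<iota>3 z) = 2 * s z ^ 3 * (2 * s z ^ 3 - 35) * \<omega> z"
      using r(2) unfolding r(3-) \<iota>3_def by (simp add: field_simps eval_nat_numeral)
    then show ?thesis
      using s_nonzero[OF z(1)] regular(3)[OF z(1)] by simp (simp add: eval_nat_numeral)
  qed
  also have "\<dots> = X z"
    using s_nonzero[OF z(1)] by (simp add: \<omega>_def)
  finally show ?thesis .
qed

lemma condition2_holds:
  assumes z: "z \<in> U" "applies t z"
  shows "condition2 t z"
  using J_nonzero[OF z(1)] nonzero[OF z(1)]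
  by (simp add: condition2_def N_eq[OF z] M_eq[OF z] I2_def Omega_eq[OF z] I7_eq[OF z] I21_eq[OF z])

lemma condition5_holds:
  assumes z: "z \<in> U" "applies t z"
  shows "condition5 \<beta> t z"
proof -
  define k l m where "k = 2 * s z ^ 3 - 5" and "l = 2 * s z ^ 3 - 35" and "m = 2 * s z ^ 3 + 1"
  have nz: "k \<noteq> 0" "m \<noteq> 0" "l \<noteq> 0" "s z \<noteq> 0"
    using regular[OF z(1)] s_nonzero[OF z(1)] by (auto simp: k_def m_def l_def)
  have I9: "I9 t z = - (64 / 625) * (s z ^ 18 * l ^ 4 / (\<beta> ^ 2 * m ^ 8 * k ^ 3))"
    unfolding I9_eq[OF z] \<iota>9_def k_def l_def m_def ..
  show ?thesis
    using nz \<beta> unfolding condition5_def beta_squared_def condition3_ytilde(3)[OF z] cube[OF z(1)] I9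
      k_def[symmetric] l_def[symmetric] m_def[symmetric]
    by (simp add: field_simps eval_nat_numeral)
qed

text \<open>I3 and I6 are affine in X, and \<open>h\<close> is the ratio of their X-coefficients.
  Hence I6 - h I3 depends on Y alone, K1 expressing this remainder through I1, and the derivatives
  along gamma have ratio \<open>h\<close>, whose square appears in K2.\<close>

lemma condition6_holds:
  assumes z: "z \<in> U" "applies t z"
  shows "condition6 t z"
proof -
  note r = reciprocals[OF z(1)]
  have s: "s z \<noteq> 0" using s_nonzero[OF z(1)] .
  \<comment> \<open>With s^3 expressed through \<tau>, the term in 1/s becomes s^2 times a function
    of \<tau>, and the whole s^2 times a polynomial in \<tau>.\<close>
  have Y1: "\<iota>3Y1 z = - (2 / 45 * s z ^ 2 * \<tau> z ^ 2 * (1 - 150 * \<tau> z + 324 * \<tau> z ^ 2))"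
  proof -
    have "2 / (3 * s z * \<tau> z) = s z ^ 2 * (2 / (3 * s z ^ 3 * \<tau> z))"
      using s r(2) by (simp add: field_simps eval_nat_numeral)
    also have "\<dots> = s z ^ 2 * (4 / (3 * (1 - \<tau> z)))"
      unfolding r(3) using r(2,8) by (simp add: field_simps)
    finally have e: "2 / (3 * s z * \<tau> z) = s z ^ 2 * (4 / (3 * (1 - \<tau> z)))" .
    show ?thesis using r(8) unfolding \<iota>3Y1_def e by (simp add: field_simps eval_nat_numeral)
  qed
  have \<delta>: "\<delta> z = - (9 * (1 - \<tau> z) / (\<tau> z * (1 - 6 * \<tau> z)))"
    using r(2,9) unfolding \<delta>_def r by (simp add: field_simps)
  define h where "h = 6 * (4 * (s z ^ 3) ^ 2 - 296 * s z ^ 3 + 175) / ((2 * s z ^ 3 - 5) * (2 * s z ^ 3 - 35))"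
  have "4 * (s z ^ 3) ^ 2 - 296 * s z ^ 3 + 175 = (1 - 150 * \<tau> z + 324 * \<tau> z ^ 2) / \<tau> z ^ 2"
    using r(2) unfolding r(3) by (simp add: field_simps eval_nat_numeral)
  then have h: "h = 6 * (1 - 150 * \<tau> z + 324 * \<tau> z ^ 2) / ((1 - 6 * \<tau> z) * (1 - 36 * \<tau> z))"
    unfolding h_def r(4,5) using r(2) by (simp add: power2_eq_square)
  have \<iota>6: "\<iota>6 z = \<delta> z * (\<iota>3Y0 z - 2 / 45 * \<omega> z * \<tau> z ^ 2 * (1 - 150 * \<tau> z + 324 * \<tau> z ^ 2))"
    unfolding \<iota>6_def Y1 \<omega>_def by (simp add: algebra_simps)
  define k l where "k = 1 - 6 * \<tau> z" and "l = 1 - 36 * \<tau> z"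
  have kl: "k \<noteq> 0" "l \<noteq> 0" using r(9,10) by (simp_all add: k_def l_def)
  have \<iota>1: "\<iota>1 z = 18 * (1 - \<tau> z) * (1 - 36 * \<tau> z) / (5 * (1 - 6 * \<tau> z) ^ 2)"
    unfolding \<iota>1_def r(4,5) k_def[symmetric] l_def[symmetric] unfolding r(3) using r(2) kl
    by (simp add: field_simps power2_eq_square)
  have "K1 t z = \<iota>6 z - h * \<iota>3 z + (2 * s z ^ 3 - 1) * (2 * s z ^ 3 - 5) * \<iota>1 z / (9 * (2 * s z ^ 3 + 1) ^ 2)"
    unfolding K1_def condition3_ytilde(3)[OF z] cube[OF z(1)] I6_eq[OF z] I3_eq[OF z] I1_eq[OF z] h_def by simp
  also have "\<dots> = - (9 * (1 - \<tau> z) / (\<tau> z * k)) * (\<iota>3Y0 z - 2 / 45 * \<omega> z * \<tau> z ^ 2 * (1 - 150 * \<tau> z + 324 * \<tau> z ^ 2))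
      - 6 * (1 - 150 * \<tau> z + 324 * \<tau> z ^ 2) / (k * l) * ((1 - \<tau> z) * l * (2 - \<tau> z + 2 * \<omega> z * \<tau> z) / 30)
      + 2 / 5 * (1 - 2 * \<tau> z) * (1 - \<tau> z) * l / k"
    unfolding \<iota>6 \<delta> h \<iota>1 \<iota>3_def r(1,5,7) k_def[symmetric] l_def[symmetric] using r(2) kl
    by (simp add: field_simps power2_eq_square)
  also have "\<dots> = 0"
    using r(2) kl unfolding \<iota>3Y0_def by (simp add: field_simps) (simp add: l_def algebra_simps eval_nat_numeral)
  finally have 1: "K1 t z = 0" .
  have "\<delta> z * \<iota>3Y1 z = h * \<iota>3X z"
    using r(2) kl unfolding \<delta> Y1 h \<iota>3X_def k_def[symmetric] l_def[symmetric]
    by (simp add: field_simps power2_eq_square)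
  then have "I15 t z = h ^ 2 * I9 t z"
    unfolding I15_eq_g[OF z] I9_eq_g[OF z] by (simp add: power_mult_distrib)
  moreover have "I9 t z \<noteq> 0" using condition5_holds[OF z] by (simp add: condition5_def)
  ultimately have "I15 t z / I9 t z = h ^ 2" by simp
  moreover have "(6 * q / (k * l)) ^ 2 = 36 * q ^ 2 / (l ^ 2 * k ^ 2)" for q k l :: 'a
    by (simp add: power_mult_distrib power_divide mult.commute)
  ultimately have "K2 t z = 0"
    unfolding K2_def condition3_ytilde(3)[OF z] cube[OF z(1)] h_def by (simp only: diff_self)
  with 1 show ?thesis by (simp add: condition6_def)
qed

end

section \<open>Coefficients of an equation connected to the target\<close>

context p34_transformation
begin

text \<open>With second derivatives replaced by the symbols, the transformed equation is J times the
  difference between w and the geodesic right-hand side. This vanishes for every slope p with a + b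
  p nonzero, hence as a polynomial over the infinite base field.\<close>

lemma coefficients_of_connected_equation:
  fixes P Q R S :: "'a \<times> 'a \<Rightarrow> 'a"
  assumes z: "z \<in> U"
    and eq: "\<And>p w. totderiv X z p \<noteq> 0 \<Longrightarrow> w = cubic_ode.rhs P Q R S z p \<Longrightarrow>
      prolong2 X Y z p w = \<rho> z * prolong1 X Y z p ^ 2 + \<pi> z"
  shows "P z = - p2 z" "Q z = (p1 z - 2 * q2 z) / 3" "R z = (2 * q1 z - r2 z) / 3" "S z = r1 z"
proof -
  note pdx = partials_pdx[OF partials_a z] partials_pdx[OF partials_b z] partials_pdx[OF partials_c z]
    partials_pdx[OF partials_d z]
    and pdy = partials_pdy[OF partials_b z] partials_pdy[OF partials_d z]
  have ab: "a z \<noteq> 0 \<or> b z \<noteq> 0" using J_nonzero[OF z] by (auto simp: J_def)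
  define c0 c1 c2 c3 where "c0 = P z + p2 z" and "c1 = 3 * Q z - (p1 z - 2 * q2 z)"
    and "c2 = 3 * R z - (2 * q1 z - r2 z)" and "c3 = S z - r1 z"
  \<comment> \<open>The factor a + b p takes care of the one slope p at which the image curve is vertical.\<close>
  have "poly ([:a z, b z:] * [:c0, c1, c2, c3:]) p = 0" for p
  proof (cases "a z + b z * p = 0")
    case True
    then have "poly [:a z, b z:] p = 0" by (simp add: mult.commute)
    then show ?thesis by (simp only: poly_mult mult_zero_left)
  next
    case False
    define w where "w = P z + 3 * Q z * p + 3 * R z * p ^ 2 + S z * p ^ 3"
    define x1 y1 x2 y2 where "x1 = a z + b z * p" and "y1 = c z + d z * p"
      and "x2 = totderiv2 X z p w" and "y2 = totderiv2 Y z p w"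
    have x1: "x1 \<noteq> 0" using False by (simp add: x1_def)
    have "prolong2 X Y z p w = \<rho> z * prolong1 X Y z p ^ 2 + \<pi> z"
      by (rule eq) (use False in \<open>simp_all add: totderiv_def pd_def w_def cubic_ode.rhs_def\<close>)
    then have "(y2 * x1 - y1 * x2) / x1 ^ 3 = \<rho> z * (y1 / x1) ^ 2 + \<pi> z"
      by (simp add: prolong1_def prolong2_def totderiv_def pd_def x1_def y1_def x2_def y2_def)
    then have "y2 * x1 - y1 * x2 = (\<rho> z * (y1 / x1) ^ 2 + \<pi> z) * x1 ^ 3"
      using x1 by (simp only: divide_eq_eq power_eq_0_iff) simp
    then have *: "y2 * x1 - y1 * x2 = \<rho> z * y1 ^ 2 * x1 + \<pi> z * x1 ^ 3"
      using x1 by (simp add: algebra_simps power_divide) (simp add: eval_nat_numeral)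
    have "y2 * x1 - y1 * x2 - (\<rho> z * y1 ^ 2 * x1 + \<pi> z * x1 ^ 3)
        = J z * (w + p2 z - (p1 z - 2 * q2 z) * p - (2 * q1 z - r2 z) * p ^ 2 - r1 z * p ^ 3)"
      unfolding x1_def y1_def x2_def y2_def totderiv2_def pd_def
      by (simp add: pdx pdy J_def eval_nat_numeral algebra_simps)
    then have "w + p2 z - (p1 z - 2 * q2 z) * p - (2 * q1 z - r2 z) * p ^ 2 - r1 z * p ^ 3 = 0"
      using * J_nonzero[OF z] by simp
    then have "poly [:c0, c1, c2, c3:] p = 0"
      by (simp add: w_def c0_def c1_def c2_def c3_def algebra_simps eval_nat_numeral)
    then show ?thesis by (simp only: poly_mult mult_zero_right)
  qed
  then have "[:a z, b z:] * [:c0, c1, c2, c3:] = 0"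
    using poly_all_0_iff_0 by blast
  then have "c0 = 0 \<and> c1 = 0 \<and> c2 = 0 \<and> c3 = 0"
    using ab by (simp only: mult_eq_0_iff) auto
  then show "P z = - p2 z" "Q z = (p1 z - 2 * q2 z) / 3" "R z = (2 * q1 z - r2 z) / 3" "S z = r1 z"
    by (simp_all add: c0_def c1_def c2_def c3_def eq_neg_iff_add_eq_0 eq_divide_eq mult.commute)
qed

end

subsection \<open>Equivalence\<close>

lemma deriv_cong_on:
  assumes "open T" "x \<in> T" "\<And>t. t \<in> T \<Longrightarrow> f t = g t"
  shows "deriv f x = deriv g x"
  using assms by (intro deriv_cong_ev) (auto intro: eventually_mono[OF eventually_nhds_in_open])

lemma pdx_cong:
  fixes f g :: "'a::real_normed_field \<times> 'a \<Rightarrow> 'a"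
  assumes "open T" "z \<in> T" "\<And>z. z \<in> T \<Longrightarrow> f z = g z"
  shows "pdx f z = pdx g z" "pdy f z = pdy g z"
proof -
  have "open ((\<lambda>t. (t, snd z)) -` T)" "open ((\<lambda>t. (fst z, t)) -` T)"
    by (auto intro!: open_vimage assms(1) continuous_intros)
  then show "pdx f z = pdx g z" "pdy f z = pdy g z"
    unfolding pdx_def pdy_def using assms(2,3)
    by (auto intro: deriv_cong_on[of "(\<lambda>t. (t, snd z)) -` T"] deriv_cong_on[of "(\<lambda>t. (fst z, t)) -` T"])
qed

lemma pd_cong:
  assumes "open T" "\<And>z. z \<in> T \<Longrightarrow> f z = g z" "z \<in> T"
  shows "pd i j f z = pd i j g z"
proof -
  have y: "(pdy ^^ j) f z = (pdy ^^ j) g z" if "z \<in> T" for z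
    using that by (induction j arbitrary: z) (auto intro!: pdx_cong[OF assms(1)] assms(2))
  have "(pdx ^^ i) ((pdy ^^ j) f) z = (pdx ^^ i) ((pdy ^^ j) g) z" if "z \<in> T" for z
    using that by (induction i arbitrary: z) (auto intro!: pdx_cong[OF assms(1)] y)
  with assms(3) show ?thesis by (simp add: pd_def)
qed

text \<open>On an open set the values determine all partial derivatives. This lets
  \<open>xtilde\<close> and \<open>ytilde\<close> replace X and Y in condition 4.\<close>

lemma connects_cong:
  assumes c: "connects U f W g X Y" and T: "open T" "T \<subseteq> U"
    and eq: "\<And>z. z \<in> T \<Longrightarrow> X' z = X z" "\<And>z. z \<in> T \<Longrightarrow> Y' z = Y z"
  shows "connects T f W g X' Y'"
proof -
  have s: "smooth_on T X'" "smooth_on T Y'"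
    using c T eq by (auto simp: connects_def intro: smooth_on_cong smooth_on_subset)
  have e: "jacobian X' Y' z = jacobian X Y z" "totderiv X' z = totderiv X z"
    "prolong1 X' Y' z = prolong1 X Y z" "prolong2 X' Y' z = prolong2 X Y z" if z: "z \<in> T" for z
    using pd_cong[OF T(1) eq(1) z] pd_cong[OF T(1) eq(2) z]
      pdx_cong[OF T(1) z eq(1)] pdx_cong[OF T(1) z eq(2)]
    by (simp_all add: fun_eq_iff jacobian_def totderiv_def totderiv2_def prolong1_def prolong2_def)
  show ?thesis
    unfolding connects_def
  proof (intro conjI s ballI)
    fix z assume z: "z \<in> T"
    with T(2) have "z \<in> U" by blast
    with c show "(X' z, Y' z) \<in> W" "jacobian X' Y' z \<noteq> 0"
      "\<forall>p w. totderiv X' z p \<noteq> 0 \<longrightarrow>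
         (w = f z p \<longleftrightarrow> prolong2 X' Y' z p w = g (X' z, Y' z) (prolong1 X' Y' z p))"
      unfolding e[OF z] eq(1)[OF z] eq(2)[OF z] connects_def by blast+
  qed
qed

text \<open>Values are removed one at a time; were nothing left, Y would be constant on the current
  open set, against its nonzero gradient.\<close>

lemma open_avoiding_values:
  fixes Y :: "'a::real_normed_field \<times> 'a \<Rightarrow> 'a"
  assumes "finite F" "open U" "U \<noteq> {}" "smooth_on U Y" "\<And>z. z \<in> U \<Longrightarrow> pdx Y z \<noteq> 0 \<or> pdy Y z \<noteq> 0"
  shows "\<exists>T. open T \<and> T \<noteq> {} \<and> T \<subseteq> U \<and> (\<forall>z\<in>T. Y z \<notin> F)"
  using assms(1)
proof induction
  case empty
  then show ?case using assms by blast
next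
  case (insert v F)
  then obtain T where T: "open T" "T \<noteq> {}" "T \<subseteq> U" "\<forall>z\<in>T. Y z \<notin> F" by blast
  define T' where "T' = T \<inter> Y -` (- {v})"
  have "open T'"
    unfolding T'_def
    using continuous_open_preimage[OF smooth_on_continuous_on[OF smooth_on_subset[OF assms(4) T(3)]] T(1)]
    by blast
  moreover have "T' \<noteq> {}"
  proof
    assume "T' = {}"
    then have "partials T Y (\<lambda>_. 0) (\<lambda>_. 0)"
      by (intro partials_cong[OF partials_const[of T v] T(1)]) (auto simp: T'_def)
    moreover obtain z where "z \<in> T" using T(2) by blast
    ultimately show False
      using assms(5)[of z] T(3) partials_pdx[of T Y _ _ z] partials_pdy[of T Y _ _ z] by auto
  qed
  ultimately show ?case using T by (intro exI[of _ T']) (auto simp: T'_def)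
qed

lemma smooth_on_pd: "smooth_on U f \<Longrightarrow> smooth_on U (pd i j f)"
proof -
  assume f: "smooth_on U f"
  have "smooth_on U ((pdy ^^ j) f)" by (induction j) (auto intro: smooth_on_pdy f)
  then have "smooth_on U ((pdx ^^ i) ((pdy ^^ j) f))" by (induction i) (auto intro: smooth_on_pdx)
  then show ?thesis by (simp add: pd_def)
qed

lemma (in cubic_ode) smooth_on_A_B:
  assumes "open U" "smooth_on U P" "smooth_on U Q" "smooth_on U R" "smooth_on U S"
  shows "smooth_on U A" "smooth_on U B"
  unfolding A_def B_def
  by (intro smooth_on_intros smooth_on_pd assms)+

theorem theorem2:
  fixes P Q R S :: "'a::real_normed_field \<times> 'a \<Rightarrow> 'a"
    and D :: "('a \<times> 'a) set" and V :: "'a set" and cbrt :: "'a \<Rightarrow> 'a" and \<beta> :: 'a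
  assumes "\<beta> \<noteq> 0"
    and "cube_root_branch V cbrt"
    and "open D"
    and "smooth_on D P" "smooth_on D Q" "smooth_on D R" "smooth_on D S"
  shows "(\<exists>U. open U \<and> U \<noteq> {} \<and> U \<subseteq> D \<and>
            equivalent_on U (cubic_ode.rhs P Q R S) (UNIV \<times> V) (painleve34 cbrt \<beta>)) \<longleftrightarrow>
         (\<exists>U. open U \<and> U \<noteq> {} \<and> U \<subseteq> D \<and> cubic_ode.conditions_on P Q R S V cbrt \<beta> U)"
proof
  assume "\<exists>U. open U \<and> U \<noteq> {} \<and> U \<subseteq> D \<and>
            equivalent_on U (cubic_ode.rhs P Q R S) (UNIV \<times> V) (painleve34 cbrt \<beta>)"
  then obtain W X Y where W: "open W" "W \<noteq> {}" "W \<subseteq> D"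
    and con: "connects W (cubic_ode.rhs P Q R S) (UNIV \<times> V) (painleve34 cbrt \<beta>) X Y"
    by (auto simp: equivalent_on_def)
  have XY: "smooth_on W X" "smooth_on W Y" "\<And>z. z \<in> W \<Longrightarrow> Y z \<in> V"
    "\<And>z. z \<in> W \<Longrightarrow> jacobian X Y z \<noteq> 0"
    using con by (auto simp: connects_def)
  have "pdx Y z \<noteq> 0 \<or> pdy Y z \<noteq> 0" if "z \<in> W" for z
    using XY(4)[OF that] by (auto simp: jacobian_def)
  then have "\<exists>U. open U \<and> U \<noteq> {} \<and> U \<subseteq> W \<and> (\<forall>z\<in>U. Y z \<notin> {- 1 / 2, 5 / 2, 35 / 2})"
    by (intro open_avoiding_values[OF _ W(1,2) XY(2)]) auto
  then obtain U where U: "open U" "U \<noteq> {}" "U \<subseteq> W" and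
    F: "\<And>z. z \<in> U \<Longrightarrow> Y z \<notin> {- 1 / 2, 5 / 2, 35 / 2}"
    by blast
  define s where "s z = cbrt (Y z)" for z
  note cube_root = cube_root_branch_DERIV[OF assms(2) XY(3)]
  have Y: "Y z = s z ^ 3" "s z \<noteq> 0" if "z \<in> U" for z
    using cube_root(1,2)[of z] that U(3) by (auto simp: s_def)
  have "partials U (\<lambda>z. cbrt (Y z)) (\<lambda>z. 1 / (3 * cbrt (Y z) ^ 2) * pdx Y z)
      (\<lambda>z. 1 / (3 * cbrt (Y z) ^ 2) * pdy Y z)"
    using cube_root(3) U(3)
    by (intro partials_compose[where \<phi>' = "\<lambda>y. 1 / (3 * cbrt y ^ 2)"]
        smooth_on_partials[OF smooth_on_subset[OF XY(2) U(3)]]) auto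
  then have s: "partials U s (\<lambda>z. pdx Y z / (3 * s z ^ 2)) (\<lambda>z. pdy Y z / (3 * s z ^ 2))"
    by (simp add: s_def[abs_def])
  interpret p34_transformation U X Y s \<beta>
    using U XY Y s by unfold_locales (auto intro: smooth_on_subset)
  have eq: "prolong2 X Y z p w = \<rho> z * prolong1 X Y z p ^ 2 + \<pi> z"
    if "z \<in> U" "totderiv X z p \<noteq> 0" "w = cubic_ode.rhs P Q R S z p" for z p w
  proof -
    have "prolong2 X Y z p w = painleve34 cbrt \<beta> (X z, Y z) (prolong1 X Y z p)"
      using con that U(3) by (auto simp: connects_def)
    also have "\<dots> = \<rho> z * prolong1 X Y z p ^ 2 + \<pi> z"
      unfolding painleve34_def prod.case s_def[symmetric]
      unfolding \<rho>_def \<pi>_def Y(1)[OF that(1)] by simp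
    finally show ?thesis .
  qed
  interpret p34_regular_pullback P Q R S U X Y s \<beta>
  proof unfold_locales
    fix z assume z: "z \<in> U"
    show "P z = - p2 z" "Q z = (p1 z - 2 * q2 z) / 3" "R z = (2 * q1 z - r2 z) / 3" "S z = r1 z"
      using coefficients_of_connected_equation[OF z eq[OF z]] by blast+
    have "Y z \<noteq> - 1 / 2" "Y z \<noteq> 5 / 2" "Y z \<noteq> 35 / 2" using F[OF z] by auto
    then show "2 * s z ^ 3 + 1 \<noteq> 0" "2 * s z ^ 3 - 5 \<noteq> 0" "2 * s z ^ 3 - 35 \<noteq> 0"
      unfolding Y(1)[OF z, symmetric] by (auto simp: field_simps eq_neg_iff_add_eq_0)
  qed (use assms in auto)
  have "conditions_on V cbrt \<beta> U"
    unfolding conditions_on_def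
  proof (intro conjI ballI allI)
    fix z assume z: "z \<in> U"
    then have "a z \<noteq> 0 \<or> b z \<noteq> 0" using J_nonzero[OF z] by (auto simp: J_def)
    then show "condition1 z"
      using nonzero[OF z] by (auto simp: condition1_iff[OF z] A_eq[OF z] B_eq[OF z])
  next
    fix t z assume z: "z \<in> {z \<in> U. applies t z}"
    then show "condition2 t z" "condition3 t z" "condition5 \<beta> t z" "condition6 t z"
      by (auto intro: condition2_holds condition3_ytilde(1) condition5_holds condition6_holds)
  next
    fix t
    have "ytilde_denom t z \<noteq> 0" "2 * ytilde t z - 35 \<noteq> 0" if "z \<in> U" "applies t z" for z
      using condition3_ytilde(2,3)[OF that] regular(3)[OF that(1)] by (simp_all add: Y(1)[OF that(1)])
    \<comment> \<open>Where the formulas apply, \<open>xtilde\<close> and \<open>ytilde\<close> are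
      X and Y themselves, so the given map is the invariant one.\<close>
    moreover have "connects {z \<in> U. applies t z} rhs (UNIV \<times> V) (painleve34 cbrt \<beta>)
        (xtilde cbrt t) (ytilde t)"
      by (rule connects_cong[OF con open_applies])
        (use U(3) in \<open>auto simp: condition3_ytilde(3) xtilde_eq_X s_def\<close>)
    ultimately show "condition4 V cbrt \<beta> t {z \<in> U. applies t z}"
      by (auto simp: condition4_def)
  qed
  with U W show "\<exists>U. open U \<and> U \<noteq> {} \<and> U \<subseteq> D \<and> cubic_ode.conditions_on P Q R S V cbrt \<beta> U"
    by blast
next
  interpret cubic_ode P Q R S .
  assume "\<exists>U. open U \<and> U \<noteq> {} \<and> U \<subseteq> D \<and> conditions_on V cbrt \<beta> U"
  then obtain U where U: "open U" "U \<noteq> {}" "U \<subseteq> D" "conditions_on V cbrt \<beta> U" by blast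
  then obtain z where z: "z \<in> U" "A z \<noteq> 0 \<or> B z \<noteq> 0"
    by (auto simp: conditions_on_def condition1_def)
  \<comment> \<open>A set of formulas that applies at z applies on an open set around it, and
    condition 4 for that set supplies the transformation there.\<close>
  then obtain t where t: "applies t z" using applies.simps by blast
  let ?T = "{z \<in> U. applies t z}"
  have AB: "smooth_on U A" "smooth_on U B"
    using smooth_on_A_B[OF assms(3-7)] smooth_on_subset U(3) by blast+
  have "open (U \<inter> f -` (- {0}))" if "smooth_on U f" for f :: "'a \<times> 'a \<Rightarrow> 'a"
    using continuous_open_preimage[OF smooth_on_continuous_on[OF that] U(1)] by blast
  from this[OF AB(1)] this[OF AB(2)] have "open ?T"
    by (cases t) (auto simp: Int_def vimage_def)
  moreover have "equivalent_on ?T rhs (UNIV \<times> V) (painleve34 cbrt \<beta>)"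
    using U(4) unfolding conditions_on_def condition4_def equivalent_on_def by blast
  ultimately show "\<exists>U. open U \<and> U \<noteq> {} \<and> U \<subseteq> D \<and>
      equivalent_on U rhs (UNIV \<times> V) (painleve34 cbrt \<beta>)"
    using z(1) t U(3) by (intro exI[of _ ?T] conjI) (blast | assumption)+
qed

end
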